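(* Let $n\ge2$, $0<s<1$, $0<p<\infty$, $1\le q<\frac{np}{n-sp}$ with $sp=1$. Then there exists a bounded continuous function $u:\mathbb{R}^n\to\mathbb{R}$ in $\dot{W}^{s,p}_q(\mathbb{R}^n)$ such that there exists no curve (continuous map) $\gamma:[0,\infty)\to\mathbb{R}^n$ with $\gamma(0)=0$ and $\lim_{t\to\infty}\gamma(t)=\infty$ (i.e. $|\gamma(t)|\to\infty$) for which the limit $\lim_{t\to\infty}u(\gamma(t))$ exists.
   Context: $u\in\dot{W}^{s,p}_q(\mathbb{R}^n)$ means that $u:\mathbb{R}^n\to\mathbb{R}$ is measurable and $\int_{\mathbb{R}^n}\Big(\int_{\mathbb{R}^n}\frac{|u(x)-u(y)|^q}{|x-y|^{n+sq}}\,dy\Big)^{p/q}dx<\infty$. *)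

theory Defs
  imports "HOL-Analysis.Analysis"
begin

(* Real powers of extended nonnegative reals; infinity to a power a > 0 is infinity.
   Only a > 0 is used. *)
definition ennreal_powr :: "ennreal \<Rightarrow> real \<Rightarrow> ennreal" where
  "ennreal_powr x a = (if x = \<infinity> then \<infinity> else ennreal (enn2real x powr a))"

(* The integrals are Lebesgue integrals with values in [0, infinity]. On the diagonal x = y,
   which is a null set in y, the quotient is 0 / 0 = 0. *)
definition W_seminorm_integral ::
    "real \<Rightarrow> real \<Rightarrow> real \<Rightarrow> (real ^ 'n \<Rightarrow> real) \<Rightarrow> ennreal" where
  "W_seminorm_integral s p q u =
     (\<integral>\<^sup>+ x. ennreal_powr
        (\<integral>\<^sup>+ y. ennreal (\<bar>u x - u y\<bar> powr q / norm (x - y) powr (real CARD('n) + s * q)) \<partial>lebesgue)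
        (p / q) \<partial>lebesgue)"

definition W_dot :: "real \<Rightarrow> real \<Rightarrow> real \<Rightarrow> (real ^ 'n \<Rightarrow> real) set" where
  "W_dot s p q = {u. u \<in> borel_measurable lebesgue \<and> W_seminorm_integral s p q u < \<infinity>}"

end

theory Submission
  imports Defs
begin

text \<open>A curve that goes to infinity must cross every large closed hypersurface around the origin. It is
therefore enough to find a function of finite energy that is one on infinitely many such
hypersurfaces and zero on infinitely many others: by the intermediate value theorem it takes both
values at arbitrarily late times on each such curve (\<open>curve_hits_cube\<close>).

Such a function exists because \<open>s * p = 1\<close> is the critical case in which hypersurfaces have zero
capacity. Let \<open>d\<close> be the distance to the hypersurface. The positive part of
\<open>- ln (d + 1 / 2 ^ N) / (N * ln 2)\<close> is one on the hypersurface and zero from distance one on. The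
logarithm changes by a bounded amount when the scale changes by a bounded factor, and so the inner
integral of the seminorm at \<open>x\<close> is at most of order
\<open>N powr - q * (d x + 1 / 2 ^ N) powr - (s * q)\<close> (\<open>nn_integral_ln_increment\<close>). Its power \<open>p / q\<close> is
\<open>N powr - p\<close> times \<open>1 / d\<close>; over the layers between depth \<open>1\<close> and \<open>1 / 2 ^ N\<close> the
function \<open>1 / d\<close> has an integral of order \<open>N\<close> only. So the energy near the hypersurface is of order
\<open>N powr (1 - p)\<close>, and this tends to zero as \<open>p > 1\<close>. Far away, the inner integral decays like the
power \<open>n + s * q\<close> of \<open>1 / norm x\<close>, where \<open>n\<close> is the dimension; the assumption
\<open>q < n * p / (n - s * p)\<close> says precisely that the power \<open>p / q\<close> of this is integrable at infinity, and its
integral comes with a factor \<open>N powr - (p / q)\<close>. Both parts are in \<open>energy_bump_le\<close>.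

The large number of surfaces and their growing size are harmless, since each bump can be made
arbitrarily cheap before they are combined (\<open>energy_countable_subadditive\<close>). Surfaces of cubes rather than round spheres
are used, because the volume of their neighbourhoods is that of a few flat boxes.\<close>

section \<open>Dyadic estimates for singular kernels\<close>

lemma dyadic_bracket:
  fixes z :: real
  assumes "1 \<le> z"
  obtains i :: nat where "2 ^ i \<le> z" "z < 2 ^ (i + 1)"
proof -
  define i where "i = nat \<lfloor>log 2 z\<rfloor>"
  have 0: "0 \<le> log 2 z" using assms by simp
  have i1: "real i \<le> log 2 z" and i2: "log 2 z < real i + 1"
    using 0 unfolding i_def by linarith+
  have "2 powr real i \<le> z" using i1 assms by (simp add: le_log_iff)
  moreover have "z < 2 powr (real i + 1)" using i2 assms by (simp add: log_less_iff)
  ultimately show thesis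
    by (intro that[of i]) (simp_all add: powr_realpow powr_add)
qed

lemma suminf_ennreal_geometric:
  fixes c r :: real
  assumes "0 \<le> c" "0 \<le> r" "r < 1"
  shows "(\<Sum>i. ennreal (c * r ^ i)) = ennreal (c / (1 - r))"
proof (rule suminf_ennreal_eq)
  show "(\<lambda>i. c * r ^ i) sums (c / (1 - r))"
    using sums_mult[OF geometric_sums[of r], of c] assms by simp
qed (use assms in auto)

lemma term_le_suminf_ennreal: "f k \<le> (\<Sum>i. f i)" for f :: "nat \<Rightarrow> ennreal"
  using sum_le_suminf[of f "{k}"] by simp

text \<open>All singular integrals below are estimated in the same way: the domain is covered by dyadic
pieces, and the bounds on the pieces form a geometric series. The functions \<open>g i\<close> play the part of
the pieces; it is enough that at each point one of them dominates the integrand.\<close>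
lemma nn_integral_le_geometric:
  fixes c r :: real
  assumes g [measurable]: "\<And>i::nat. g i \<in> borel_measurable M"
    and cover: "\<And>x. f x \<noteq> 0 \<Longrightarrow> \<exists>i. f x \<le> g i x"
    and le: "\<And>i. (\<integral>\<^sup>+ x. g i x \<partial>M) \<le> ennreal (c * r ^ i)"
    and "0 \<le> c" "0 \<le> r" "r < 1"
  shows "(\<integral>\<^sup>+ x. f x \<partial>M) \<le> ennreal (c / (1 - r))"
proof -
  have "(\<integral>\<^sup>+ x. f x \<partial>M) \<le> (\<integral>\<^sup>+ x. (\<Sum>i. g i x) \<partial>M)"
  proof (rule nn_integral_mono)
    fix x
    show "f x \<le> (\<Sum>i. g i x)"
      using cover[of x] term_le_suminf_ennreal[of "\<lambda>i. g i x"] by (cases "f x = 0") (auto intro: order_trans)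
  qed
  also have "\<dots> = (\<Sum>i. \<integral>\<^sup>+ x. g i x \<partial>M)"
    by (rule nn_integral_suminf) auto
  also have "\<dots> \<le> (\<Sum>i. ennreal (c * r ^ i))"
    by (intro suminf_le le) auto
  finally show ?thesis
    by (simp only: suminf_ennreal_geometric[OF assms(4-6)])
qed

text \<open>The mass of \<open>E\<close> grows like \<open>r powr b\<close> and the kernel decays faster, so the annulus
nearest to \<open>x\<close> dominates. The set \<open>E\<close> will be the whole space, with \<open>b\<close> the dimension, or a thin
neighbourhood of a hypersurface, with \<open>b\<close> one less and the thickness contained in \<open>A\<close>.\<close>
lemma nn_integral_kernel_tail:
  fixes x :: "'a::euclidean_space"
  assumes E [measurable]: "E \<in> sets borel"
    and dens: "\<And>r. 0 < r \<Longrightarrow> emeasure lborel (E \<inter> ball x r) \<le> ennreal (A * r powr b)"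
    and "0 \<le> A" "0 \<le> a" "b < a" "0 < \<rho>"
  shows "(\<integral>\<^sup>+ y. ennreal (norm (x - y) powr - a) * indicator {y \<in> E. \<rho> \<le> norm (x - y)} y \<partial>lborel)
           \<le> ennreal (A * \<rho> powr (b - a) * (2 powr b / (1 - 2 powr (b - a))))"
proof -
  define g where "g i y = ennreal ((\<rho> * 2 ^ i) powr - a) * indicator (E \<inter> ball x (\<rho> * 2 ^ (i + 1))) y"
    for i :: nat and y
  have "(\<integral>\<^sup>+ y. ennreal (norm (x - y) powr - a) * indicator {y \<in> E. \<rho> \<le> norm (x - y)} y \<partial>lborel)
           \<le> ennreal ((A * \<rho> powr (b - a) * 2 powr b) / (1 - 2 powr (b - a)))"
  proof (rule nn_integral_le_geometric[where g = g])
    show "g i \<in> borel_measurable lborel" for i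
      unfolding g_def using E by (intro borel_measurable_times_ennreal borel_measurable_indicator) auto
  next
    fix y
    assume "ennreal (norm (x - y) powr - a) * indicator {y \<in> E. \<rho> \<le> norm (x - y)} y \<noteq> 0"
    then have y: "y \<in> E" "\<rho> \<le> norm (x - y)" by (auto split: split_indicator_asm)
    then have "1 \<le> norm (x - y) / \<rho>" using \<open>0 < \<rho>\<close> by simp
    then obtain i where i: "2 ^ i \<le> norm (x - y) / \<rho>" "norm (x - y) / \<rho> < 2 ^ (i + 1)"
      by (rule dyadic_bracket)
    then have i': "\<rho> * 2 ^ i \<le> norm (x - y)" "norm (x - y) < \<rho> * 2 ^ (i + 1)"
      using \<open>0 < \<rho>\<close> by (simp_all add: field_simps)
    have "norm (x - y) powr - a \<le> (\<rho> * 2 ^ i) powr - a"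
      using i'(1) \<open>0 < \<rho>\<close> \<open>0 \<le> a\<close> by (intro powr_mono2') auto
    then show "\<exists>i. ennreal (norm (x - y) powr - a) * indicator {y \<in> E. \<rho> \<le> norm (x - y)} y \<le> g i y"
      using y i'(2) unfolding g_def
      by (intro exI[of _ i]) (auto simp: dist_norm intro: ennreal_leI)
  next
    fix i
    have "(\<integral>\<^sup>+ y. g i y \<partial>lborel)
        = ennreal ((\<rho> * 2 ^ i) powr - a) * emeasure lborel (E \<inter> ball x (\<rho> * 2 ^ (i + 1)))"
      unfolding g_def using E by (intro nn_integral_cmult_indicator) auto
    also have "\<dots> \<le> ennreal ((\<rho> * 2 ^ i) powr - a) * ennreal (A * (\<rho> * 2 ^ (i + 1)) powr b)"
      using \<open>0 < \<rho>\<close> by (intro mult_left_mono dens) auto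
    also have "\<dots> = ennreal ((\<rho> * 2 ^ i) powr - a * (A * (\<rho> * 2 ^ (i + 1)) powr b))"
      by (simp add: ennreal_mult')
    also have "(\<rho> * 2 ^ i) powr - a * (A * (\<rho> * 2 ^ (i + 1)) powr b)
        = A * \<rho> powr (b - a) * 2 powr b * (2 powr (b - a)) ^ i"
    proof -
      have "(2 ^ i) powr (- a) = (2 powr (- a)) ^ i" "((2::real) ^ i) powr b = (2 powr b) ^ i"
        by (simp_all add: powr_powr powr_realpow[symmetric] mult.commute)
      moreover have "(2 powr (b - a)) ^ i = (2 powr b) ^ i * ((2::real) powr (-a)) ^ i"
        by (simp flip: power_mult_distrib powr_add)
      moreover have "\<rho> powr (b - a) = \<rho> powr b * \<rho> powr (- a)"
        by (simp flip: powr_add)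
      ultimately show ?thesis
        using \<open>0 < \<rho>\<close> by (simp add: powr_mult algebra_simps)
    qed
    finally show "(\<integral>\<^sup>+ y. g i y \<partial>lborel) \<le> ennreal (A * \<rho> powr (b - a) * 2 powr b * (2 powr (b - a)) ^ i)" .
  qed (use \<open>0 \<le> A\<close> \<open>b < a\<close> powr_less_cancel_iff[of 2 "b - a" 0] in auto)
  then show ?thesis by simp
qed

lemma emeasure_ball_powr:
  fixes x :: "'a::euclidean_space"
  assumes "0 < r"
  shows "emeasure lborel (ball x r) = ennreal (unit_ball_vol (real DIM('a)) * r powr real DIM('a))"
  using assms by (simp add: emeasure_ball powr_realpow)

text \<open>The counterpart for a locally integrable kernel. The factor \<open>2 powr \<bar>a\<bar>\<close> covers both signs of
\<open>a\<close>, because the kernel increases towards \<open>x\<close> or decreases there according to the sign.\<close>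
lemma nn_integral_kernel_near:
  fixes x :: "'a::euclidean_space"
  defines "n \<equiv> real DIM('a)"
  assumes "a < n" "0 < \<rho>"
  shows "(\<integral>\<^sup>+ y. ennreal (norm (x - y) powr - a) * indicator (ball x \<rho>) y \<partial>lborel)
           \<le> ennreal (\<rho> powr (n - a) * (2 powr \<bar>a\<bar> * unit_ball_vol n * 2 powr n / (1 - 2 powr (a - n))))"
proof -
  define g where "g i y = ennreal (2 powr \<bar>a\<bar> * (\<rho> / 2 ^ i) powr - a) * indicator (ball x (2 * (\<rho> / 2 ^ i))) y"
    for i :: nat and y
  have "(\<integral>\<^sup>+ y. ennreal (norm (x - y) powr - a) * indicator (ball x \<rho>) y \<partial>lborel)
           \<le> ennreal ((\<rho> powr (n - a) * (2 powr \<bar>a\<bar> * unit_ball_vol n * 2 powr n)) / (1 - 2 powr (a - n)))"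
  proof (rule nn_integral_le_geometric[where g = g])
    show "g i \<in> borel_measurable lborel" for i
      unfolding g_def by (intro borel_measurable_times_ennreal borel_measurable_indicator) auto
  next
    fix y
    assume "ennreal (norm (x - y) powr - a) * indicator (ball x \<rho>) y \<noteq> 0"
    then have y: "x \<noteq> y" "norm (x - y) < \<rho>" by (auto simp: dist_norm split: split_indicator_asm)
    define z where "z = norm (x - y)"
    have z: "0 < z" "z < \<rho>" using y by (auto simp: z_def)
    then have "1 \<le> \<rho> / z" by simp
    then obtain i where i: "2 ^ i \<le> \<rho> / z" "\<rho> / z < 2 ^ (i + 1)"
      by (rule dyadic_bracket)
    define t where "t = \<rho> / 2 ^ i"
    have t: "0 < t" "z \<le> t" "t < 2 * z"
      using i z unfolding t_def by (simp_all add: field_simps)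
    have "z powr - a \<le> 2 powr \<bar>a\<bar> * t powr - a"
    proof (cases "0 \<le> a")
      case True
      have "z powr - a \<le> (t / 2) powr - a"
        using t True by (intro powr_mono2') auto
      also have "\<dots> = 2 powr \<bar>a\<bar> * t powr - a"
        using True t by (simp add: powr_divide powr_minus divide_simps)
      finally show ?thesis .
    next
      case False
      have "z powr - a \<le> t powr - a"
        using t z False by (intro powr_mono2) auto
      also have "\<dots> \<le> 2 powr \<bar>a\<bar> * t powr - a"
        using ge_one_powr_ge_zero[of 2 "\<bar>a\<bar>"] by (intro mult_le_cancel_right1[THEN iffD2]) auto
      finally show ?thesis .
    qed
    then show "\<exists>i. ennreal (norm (x - y) powr - a) * indicator (ball x \<rho>) y \<le> g i y"
      using y t z unfolding g_def z_def t_def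
      by (intro exI[of _ i]) (auto simp: dist_norm intro: ennreal_leI)
  next
    fix i :: nat
    have "(\<integral>\<^sup>+ y. g i y \<partial>lborel)
        = ennreal (2 powr \<bar>a\<bar> * (\<rho> / 2 ^ i) powr - a) * emeasure lborel (ball x (2 * (\<rho> / 2 ^ i)))"
      unfolding g_def by (intro nn_integral_cmult_indicator) auto
    also have "\<dots> = ennreal (2 powr \<bar>a\<bar> * (\<rho> / 2 ^ i) powr - a) *
        ennreal (unit_ball_vol n * (2 * (\<rho> / 2 ^ i)) powr n)"
      using \<open>0 < \<rho>\<close> by (subst emeasure_ball_powr) (auto simp: n_def)
    also have "\<dots> = ennreal (2 powr \<bar>a\<bar> * (\<rho> / 2 ^ i) powr - a * (unit_ball_vol n * (2 * (\<rho> / 2 ^ i)) powr n))"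
      by (simp add: ennreal_mult')
    also have "2 powr \<bar>a\<bar> * (\<rho> / 2 ^ i) powr - a * (unit_ball_vol n * (2 * (\<rho> / 2 ^ i)) powr n)
        = \<rho> powr (n - a) * (2 powr \<bar>a\<bar> * unit_ball_vol n * 2 powr n) * (2 powr (a - n)) ^ i"
    proof -
      have "(\<rho> / 2 ^ i) powr - a * (\<rho> / 2 ^ i) powr n = (\<rho> / 2 ^ i) powr (n - a)"
        by (simp flip: powr_add)
      also have "\<dots> = \<rho> powr (n - a) * (2 powr (a - n)) ^ i"
      proof -
        have "((2::real) ^ i) powr (n - a) = (2 powr (n - a)) ^ i"
          by (simp add: powr_powr powr_realpow[symmetric] mult.commute)
        moreover have "(2::real) powr (a - n) = inverse (2 powr (n - a))"
          by (simp flip: powr_minus)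
        moreover have "(\<rho> / 2 ^ i) powr (n - a) = \<rho> powr (n - a) / (2 ^ i) powr (n - a)"
          using \<open>0 < \<rho>\<close> by (simp add: powr_divide)
        ultimately show ?thesis
          by (simp only: power_inverse divide_inverse)
      qed
      finally have "(\<rho> / 2 ^ i) powr - a * (\<rho> / 2 ^ i) powr n = \<rho> powr (n - a) * (2 powr (a - n)) ^ i" .
      moreover have "(2 * (\<rho> / 2 ^ i)) powr n = 2 powr n * (\<rho> / 2 ^ i) powr n"
        using \<open>0 < \<rho>\<close> by (subst powr_mult) auto
      ultimately show ?thesis
        by (simp only: mult_ac)
    qed
    finally show "(\<integral>\<^sup>+ y. g i y \<partial>lborel)
        \<le> ennreal (\<rho> powr (n - a) * (2 powr \<bar>a\<bar> * unit_ball_vol n * 2 powr n) * (2 powr (a - n)) ^ i)"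
      by simp
  qed (use \<open>a < n\<close> powr_less_cancel_iff[of 2 "a - n" 0] in \<open>auto simp: n_def\<close>)
  then show ?thesis by simp
qed

lemma ln_powr_le_powr:
  fixes w a q :: real
  assumes "1 \<le> w" "0 < a" "0 < q"
  shows "ln w powr q \<le> (q / a) powr q * w powr a"
proof -
  have "ln w = (q / a) * ln (w powr (a / q))"
    using assms by (simp add: ln_powr)
  also have "\<dots> \<le> (q / a) * w powr (a / q)"
    using assms by (intro mult_left_mono ln_bound) auto
  finally have "ln w powr q \<le> ((q / a) * w powr (a / q)) powr q"
    using assms by (intro powr_mono2) auto
  also have "\<dots> = (q / a) powr q * w powr a"
    using assms by (subst powr_mult) (auto simp: powr_powr)
  finally show ?thesis .
qed

lemma abs_ln_diff_le:
  fixes a b m :: real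
  assumes "0 < m" "m \<le> a" "m \<le> b"
  shows "\<bar>ln a - ln b\<bar> \<le> \<bar>a - b\<bar> / m"
proof -
  have *: "ln a - ln b \<le> \<bar>a - b\<bar> / m" if "m \<le> a" "m \<le> b" for a b :: real
  proof -
    have "ln a - ln b \<le> (a - b) / b"
      using that assms ln_diff_le[of a b] by simp
    also have "\<dots> \<le> \<bar>a - b\<bar> / m"
      using that assms by (intro frac_le) auto
    finally show ?thesis .
  qed
  show ?thesis using *[of a b] *[of b a] assms by (simp add: abs_minus_commute abs_le_iff)
qed

section \<open>The increments of a logarithm\<close>

text \<open>The key estimate. The scale of \<open>e\<close> at \<open>x\<close> is \<open>e x\<close>, and the logarithm turns changes of scale into
bounded increments, so by homogeneity the integral should be of order \<open>e x powr - (s * q)\<close>. With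
\<open>\<rho> = e x / 2\<close>, this holds on three regions. For \<open>norm (x - y) < \<rho>\<close> the logarithm of \<open>e\<close> is Lipschitz with
constant \<open>1 / \<rho>\<close>. Further away, where \<open>e y\<close> is larger than \<open>e x\<close>, the Lipschitz bound limits the ratio by a
multiple of \<open>norm (x - y) / \<rho>\<close>, and the logarithm costs less than any power of that. Where \<open>e y\<close> is smaller, the
ratio is unbounded, but the density assumption says that \<open>e y < t\<close> happens only on a set of
thickness \<open>t\<close>, so that the power \<open>1 / 2\<close> of the ratio remains integrable. The constant \<open>C\<close> does not
depend on \<open>e\<close>; this uniformity is what permits to let the singularity of \<open>ln e\<close> develop later on.\<close>
lemma nn_integral_ln_increment:
  fixes K s q :: real
  defines "n \<equiv> real DIM('a::euclidean_space)"
  assumes "0 \<le> K" "0 < s" "s < 1" "1 \<le> q"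
  obtains C where "0 \<le> C"
    and "\<And>(e :: 'a \<Rightarrow> real) x.
      \<lbrakk>\<And>x. 0 < e x; \<And>x y. \<bar>e x - e y\<bar> \<le> norm (x - y);
       \<And>x t r. \<lbrakk>0 < t; 0 < r\<rbrakk> \<Longrightarrow>
         emeasure lborel ({y. e y < t} \<inter> ball x r) \<le> ennreal (K * t * r powr (n - 1))\<rbrakk>
      \<Longrightarrow> (\<integral>\<^sup>+ y. ennreal (\<bar>ln (e x) - ln (e y)\<bar> powr q / norm (x - y) powr (n + s * q)) \<partial>lborel)
            \<le> ennreal (C * e x powr - (s * q))"
proof -
  have n: "1 \<le> n" unfolding n_def using DIM_positive[where 'a='a] by linarith
  have sq: "0 < s * q" "s * q < q" using assms by auto
  define a where "a = n + s * q"
  define b where "b = n + s * q / 2"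
  define c1 where "c1 = 2 powr \<bar>a - q\<bar> * unit_ball_vol n * 2 powr n / (1 - 2 powr (a - q - n))"
  define L1 where "L1 = (q / (s * q / 2)) powr q * (3 / 2) powr (s * q / 2)"
  define c2 where "c2 = 2 powr n / (1 - 2 powr (n - b))"
  define L2 where "L2 = (q / (1 / 2)) powr q"
  define \<theta> where "\<theta> = 2 powr (1 / 2) / (2::real)"
  define c3 where "c3 = 2 powr (n - 1) / (1 - 2 powr (n - 1 - a))"
  define C where "C = 2 powr (s * q) *
    (c1 + L1 * (unit_ball_vol n * c2) + L2 * (2 powr (1 / 2) * K * 4 * c3) / (1 - \<theta>))"
  have lt1: "2 powr (a - q - n) < 1" "2 powr (n - b) < 1" "2 powr (n - 1 - a) < 1"
    using powr_less_cancel_iff[of 2 "a - q - n" 0] powr_less_cancel_iff[of 2 "n - b" 0]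
      powr_less_cancel_iff[of 2 "n - 1 - a" 0] sq n
    unfolding a_def b_def by auto
  have \<theta>: "0 \<le> \<theta>" "\<theta> < 1"
    using powr_less_cancel_iff[of 2 "1/2" 1] unfolding \<theta>_def by auto
  have nonneg: "0 \<le> c1" "0 \<le> c2" "0 \<le> c3" "0 \<le> L1" "0 \<le> L2" "0 \<le> unit_ball_vol n"
    unfolding c1_def c2_def c3_def L1_def L2_def using lt1 n by auto
  show thesis
  proof (rule that)
    show "0 \<le> C"
      unfolding C_def using nonneg \<theta> \<open>0 \<le> K\<close>
      by (intro mult_nonneg_nonneg add_nonneg_nonneg divide_nonneg_nonneg) auto
  next
    fix e :: "'a \<Rightarrow> real" and x
    assume pos: "\<And>x. 0 < e x" and lip: "\<And>x y. \<bar>e x - e y\<bar> \<le> norm (x - y)"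
      and dens: "\<And>x t r. \<lbrakk>0 < t; 0 < r\<rbrakk> \<Longrightarrow>
         emeasure lborel ({y. e y < t} \<inter> ball x r) \<le> ennreal (K * t * r powr (n - 1))"
    have "continuous_on UNIV e"
      using lip by (intro lipschitz_on_continuous_on[of 1] lipschitz_onI) (auto simp: dist_real_def dist_norm)
    then have e [measurable]: "e \<in> borel_measurable borel"
      by (rule borel_measurable_continuous_onI)
    define \<rho> where "\<rho> = e x / 2"
    have \<rho>: "0 < \<rho>" "e x = 2 * \<rho>" using pos[of x] by (auto simp: \<rho>_def)
    \<comment> \<open>One majorant for each of the three regions; \<open>L1\<close> and \<open>L2\<close> come from bounding a logarithm by a power.\<close>
    define f1 where "f1 y = ennreal (\<rho> powr - q) *
        (ennreal (norm (x - y) powr - (a - q)) * indicator (ball x \<rho>) y)" for y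
    define f2 where "f2 y = ennreal (L1 * \<rho> powr - (s * q / 2)) *
        (ennreal (norm (x - y) powr - b) * indicator {y \<in> UNIV. \<rho> \<le> norm (x - y)} y)" for y
    define f3 where "f3 y = ennreal (L2 * (e x / e y) powr (1 / 2)) *
        (ennreal (norm (x - y) powr - a) * indicator {y. e y < e x \<and> \<rho> \<le> norm (x - y)} y)" for y
    have [measurable]: "(\<lambda>y. ennreal (norm (x - y) powr c)) \<in> borel_measurable borel"
        "{y. c \<le> norm (x - y)} \<in> sets borel" for c
      by measurable
    have [measurable]: "f1 \<in> borel_measurable borel"
      unfolding f1_def by (intro borel_measurable_times_ennreal borel_measurable_indicator) auto
    have [measurable]: "f2 \<in> borel_measurable borel"
      unfolding f2_def by (intro borel_measurable_times_ennreal borel_measurable_indicator) auto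
    have [measurable]: "f3 \<in> borel_measurable borel"
      unfolding f3_def by measurable

    have pw: "ennreal (\<bar>ln (e x) - ln (e y)\<bar> powr q / norm (x - y) powr a) \<le> f1 y + f2 y + f3 y" for y
    proof -
      define r where "r = norm (x - y)"
      consider "r = 0" | "0 < r" "r < \<rho>" | "\<rho> \<le> r" "e x \<le> e y" | "\<rho> \<le> r" "e y < e x"
        unfolding r_def using norm_ge_zero[of "x - y"] by linarith
      then show ?thesis
      proof cases
        case 1
        then show ?thesis by (simp add: r_def)
      next
        case 2
        have "\<bar>ln (e x) - ln (e y)\<bar> \<le> \<bar>e x - e y\<bar> / \<rho>"
          using lip[of x y] 2 \<rho> by (intro abs_ln_diff_le) (auto simp: r_def)
        also have "\<dots> \<le> r / \<rho>" using lip[of x y] \<rho> by (simp add: r_def divide_right_mono)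
        finally have "\<bar>ln (e x) - ln (e y)\<bar> powr q \<le> (r / \<rho>) powr q"
          using \<open>1 \<le> q\<close> by (intro powr_mono2) auto
        then have "\<bar>ln (e x) - ln (e y)\<bar> powr q / r powr a \<le> (r / \<rho>) powr q / r powr a"
          by (rule divide_right_mono) simp
        also have "\<dots> = \<rho> powr - q * r powr - (a - q)"
          using 2 \<rho> by (simp add: powr_divide powr_minus powr_diff field_simps)
        finally have "ennreal (\<bar>ln (e x) - ln (e y)\<bar> powr q / norm (x - y) powr a) \<le> f1 y"
          using 2 unfolding f1_def r_def
          by (simp add: dist_norm ennreal_mult'[symmetric] ennreal_leI)
        then show ?thesis by (simp add: add_increasing2 add.assoc)
      next
        case 3
        have "0 < r" using 3 \<rho> by simp
        have "e y \<le> 3 * r" using lip[of x y] 3 \<rho> by (simp add: r_def)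
        have w: "1 \<le> e y / e x" using 3 pos[of x] by simp
        have "\<bar>ln (e x) - ln (e y)\<bar> = ln (e y / e x)"
          using 3 pos[of x] pos[of y] by (simp add: ln_div)
        then have "\<bar>ln (e x) - ln (e y)\<bar> powr q \<le> (q / (s * q / 2)) powr q * (e y / e x) powr (s * q / 2)"
          using ln_powr_le_powr[OF w, of "s * q / 2" q] sq \<open>1 \<le> q\<close> by simp
        also have "\<dots> \<le> (q / (s * q / 2)) powr q * (3 / 2 * (r / \<rho>)) powr (s * q / 2)"
          using \<open>e y \<le> 3 * r\<close> \<rho> sq w pos[of y]
          by (intro mult_left_mono powr_mono2) (auto simp: field_simps)
        also have "\<dots> = L1 * (r / \<rho>) powr (s * q / 2)"
          unfolding L1_def using \<open>0 < r\<close> \<rho> by (subst powr_mult) auto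
        finally have "\<bar>ln (e x) - ln (e y)\<bar> powr q / r powr a \<le> L1 * (r / \<rho>) powr (s * q / 2) / r powr a"
          by (rule divide_right_mono) simp
        also have "\<dots> = L1 * \<rho> powr - (s * q / 2) * r powr - b"
        proof -
          have "r powr a = r powr b * r powr (s * q / 2)"
            by (simp add: a_def b_def algebra_simps flip: powr_add)
          then show ?thesis
            using \<open>0 < r\<close> \<rho> by (simp add: powr_divide powr_minus field_simps)
        qed
        finally have "ennreal (\<bar>ln (e x) - ln (e y)\<bar> powr q / norm (x - y) powr a) \<le> f2 y"
          using 3 nonneg unfolding f2_def r_def
          by (simp add: ennreal_mult'[symmetric] ennreal_leI)
        then show ?thesis by (simp add: add_increasing add_increasing2)
      next
        case 4
        have w: "1 \<le> e x / e y" using 4 pos[of y] by simp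
        have "\<bar>ln (e x) - ln (e y)\<bar> = ln (e x / e y)"
          using 4 pos[of x] pos[of y] by (simp add: ln_div)
        then have "\<bar>ln (e x) - ln (e y)\<bar> powr q \<le> L2 * (e x / e y) powr (1 / 2)"
          using ln_powr_le_powr[OF w, of "1 / 2" q] \<open>1 \<le> q\<close> by (simp add: L2_def)
        then have "\<bar>ln (e x) - ln (e y)\<bar> powr q / r powr a \<le> L2 * (e x / e y) powr (1 / 2) / r powr a"
          by (rule divide_right_mono) simp
        also have "\<dots> = L2 * (e x / e y) powr (1 / 2) * r powr - a"
          by (simp only: powr_minus_divide times_divide_eq_right mult_1_right)
        finally have "ennreal (\<bar>ln (e x) - ln (e y)\<bar> powr q / norm (x - y) powr a) \<le> f3 y"
          using 4 nonneg unfolding f3_def r_def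
          by (simp add: ennreal_mult'[symmetric] ennreal_leI)
        then show ?thesis by (simp add: add_increasing)
      qed
    qed

    have 1: "(\<integral>\<^sup>+ y. f1 y \<partial>lborel) \<le> ennreal (c1 * \<rho> powr - (s * q))"
    proof -
      have "(\<integral>\<^sup>+ y. f1 y \<partial>lborel) = ennreal (\<rho> powr - q) *
          (\<integral>\<^sup>+ y. ennreal (norm (x - y) powr - (a - q)) * indicator (ball x \<rho>) y \<partial>lborel)"
        unfolding f1_def
        by (intro nn_integral_cmult borel_measurable_times_ennreal borel_measurable_indicator) auto
      also have "\<dots> \<le> ennreal (\<rho> powr - q) * ennreal (\<rho> powr (n - (a - q)) * c1)"
        unfolding c1_def n_def using \<rho> sq
        by (intro mult_left_mono nn_integral_kernel_near) (auto simp: a_def n_def)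
      also have "\<dots> = ennreal (\<rho> powr - q * \<rho> powr (n - (a - q)) * c1)"
        by (simp add: ennreal_mult' mult.assoc)
      also have "\<rho> powr - q * \<rho> powr (n - (a - q)) = \<rho> powr - (s * q)"
        by (simp add: a_def algebra_simps flip: powr_add)
      finally show ?thesis by (simp add: mult.commute)
    qed
    have 2: "(\<integral>\<^sup>+ y. f2 y \<partial>lborel) \<le> ennreal (L1 * (unit_ball_vol n * c2) * \<rho> powr - (s * q))"
    proof -
      have "(\<integral>\<^sup>+ y. f2 y \<partial>lborel) = ennreal (L1 * \<rho> powr - (s * q / 2)) *
          (\<integral>\<^sup>+ y. ennreal (norm (x - y) powr - b) * indicator {y \<in> UNIV. \<rho> \<le> norm (x - y)} y \<partial>lborel)"
        unfolding f2_def
        by (intro nn_integral_cmult borel_measurable_times_ennreal borel_measurable_indicator) auto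
      also have "\<dots> \<le> ennreal (L1 * \<rho> powr - (s * q / 2)) * ennreal (unit_ball_vol n * \<rho> powr (n - b) * c2)"
        unfolding c2_def using \<rho> sq n nonneg
        by (intro mult_left_mono nn_integral_kernel_tail) (auto simp: b_def emeasure_ball_powr n_def)
      also have "\<dots> = ennreal (L1 * \<rho> powr - (s * q / 2) * (unit_ball_vol n * \<rho> powr (n - b) * c2))"
        using nonneg by (simp add: ennreal_mult')
      also have "L1 * \<rho> powr - (s * q / 2) * (unit_ball_vol n * \<rho> powr (n - b) * c2)
          = L1 * (unit_ball_vol n * c2) * (\<rho> powr - (s * q / 2) * \<rho> powr (n - b))"
        by (simp only: mult_ac)
      also have "\<rho> powr - (s * q / 2) * \<rho> powr (n - b) = \<rho> powr - (s * q)"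
        by (simp add: b_def algebra_simps flip: powr_add)
      finally show ?thesis .
    qed
    \<comment> \<open>Cut into the dyadic levels of \<open>e\<close>: level \<open>i\<close> contributes \<open>2 powr (i / 2)\<close> times a thickness \<open>e x / 2 ^ i\<close>.\<close>
    have 3: "(\<integral>\<^sup>+ y. f3 y \<partial>lborel)
        \<le> ennreal (L2 * (2 powr (1 / 2) * K * 4 * c3) / (1 - \<theta>) * \<rho> powr - (s * q))"
    proof -
      \<comment> \<open>The factor two turns the bracket \<open>e y \<le> e x / 2 ^ i\<close> into a strict inequality.\<close>
      define E where "E i = {y. e y < 2 * (e x / 2 ^ i)}" for i :: nat
      have [measurable]: "E i \<in> sets borel" for i unfolding E_def by measurable
      define g where "g i y = ennreal (L2 * (2 ^ (i + 1)) powr (1 / 2)) *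
        (ennreal (norm (x - y) powr - a) * indicator {y \<in> E i. \<rho> \<le> norm (x - y)} y)" for i :: nat and y
      have "(\<integral>\<^sup>+ y. f3 y \<partial>lborel)
          \<le> ennreal ((L2 * (2 powr (1 / 2) * K * 4 * c3) * \<rho> powr - (s * q)) / (1 - \<theta>))"
      proof (rule nn_integral_le_geometric[where g = g])
        show "g i \<in> borel_measurable lborel" for i
          unfolding g_def by measurable
      next
        fix y assume "f3 y \<noteq> 0"
        then have y: "e y < e x" "\<rho> \<le> norm (x - y)"
          by (auto simp: f3_def split: split_indicator_asm)
        have "1 \<le> e x / e y" using y pos[of y] by simp
        then obtain i where i: "2 ^ i \<le> e x / e y" "e x / e y < 2 ^ (i + 1)"
          by (rule dyadic_bracket)
        have "e y \<le> e x / 2 ^ i" using i(1) pos[of y] by (simp add: field_simps)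
        moreover have "0 < e x / 2 ^ i" using pos[of x] by simp
        ultimately have "y \<in> E i" unfolding E_def mem_Collect_eq by linarith
        moreover have "(e x / e y) powr (1 / 2) \<le> (2 ^ (i + 1)) powr (1 / 2)"
          using i(2) pos[of x] pos[of y] by (intro powr_mono2) auto
        ultimately show "\<exists>i. f3 y \<le> g i y"
          using y nonneg unfolding f3_def g_def
          by (intro exI[of _ i] mult_mono) (auto intro!: ennreal_leI mult_left_mono)
      next
        fix i :: nat
        have densE: "emeasure lborel (E i \<inter> ball x r) \<le> ennreal (K * (2 * (e x / 2 ^ i)) * r powr (n - 1))"
          if "0 < r" for r
          unfolding E_def using that pos[of x] by (intro dens) auto
        have "(\<integral>\<^sup>+ y. g i y \<partial>lborel) = ennreal (L2 * (2 ^ (i + 1)) powr (1 / 2)) *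
          (\<integral>\<^sup>+ y. ennreal (norm (x - y) powr - a) * indicator {y \<in> E i. \<rho> \<le> norm (x - y)} y \<partial>lborel)"
          unfolding g_def by (rule nn_integral_cmult) measurable
        also have "\<dots> \<le> ennreal (L2 * (2 ^ (i + 1)) powr (1 / 2)) *
            ennreal (K * (2 * (e x / 2 ^ i)) * \<rho> powr (n - 1 - a) * c3)"
          unfolding c3_def using \<rho> sq n nonneg \<open>0 \<le> K\<close>
          by (intro mult_left_mono nn_integral_kernel_tail densE) (auto simp: a_def)
        also have "\<dots> = ennreal (L2 * (2 ^ (i + 1)) powr (1 / 2) * (K * (2 * (e x / 2 ^ i)) * \<rho> powr (n - 1 - a) * c3))"
          using nonneg by (intro ennreal_mult'[symmetric]) auto
        also have "L2 * (2 ^ (i + 1)) powr (1 / 2) * (K * (2 * (e x / 2 ^ i)) * \<rho> powr (n - 1 - a) * c3)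
           = L2 * (2 powr (1 / 2) * K * 4 * c3) * \<rho> powr - (s * q) * \<theta> ^ i"
        proof -
          have "(2 ^ (i + 1)) powr (1 / 2) = ((2::real) powr real (i + 1)) powr (1 / 2)"
            by (subst powr_realpow) auto
          also have "\<dots> = (2 powr (1 / 2)) powr real (i + 1)"
            by (simp only: powr_powr mult.commute)
          also have "\<dots> = (2 powr (1 / 2)) ^ (i + 1)"
            by (rule powr_realpow) simp
          finally have A: "(2 ^ (i + 1)) powr (1 / 2) / 2 ^ i = 2 powr (1 / 2) * \<theta> ^ i"
            by (simp add: \<theta>_def power_divide)
          have "\<rho> powr - (s * q) = \<rho> powr (n - 1 - a + 1)" by (simp add: a_def)
          also have "\<dots> = \<rho> powr (n - 1 - a) * \<rho>" using \<rho> by (subst powr_add) auto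
          finally have B: "e x * \<rho> powr (n - 1 - a) = 2 * \<rho> powr - (s * q)" using \<rho> by simp
          have "L2 * (2 ^ (i + 1)) powr (1 / 2) * (K * (2 * (e x / 2 ^ i)) * \<rho> powr (n - 1 - a) * c3)
              = L2 * (2 * K * c3) * ((2 ^ (i + 1)) powr (1 / 2) / 2 ^ i) * (e x * \<rho> powr (n - 1 - a))"
            by simp
          also have "\<dots> = L2 * (2 * K * c3) * (2 powr (1 / 2) * \<theta> ^ i) * (2 * \<rho> powr - (s * q))"
            by (simp only: A B)
          finally show ?thesis by simp
        qed
        finally show "(\<integral>\<^sup>+ y. g i y \<partial>lborel) \<le> ennreal (L2 * (2 powr (1 / 2) * K * 4 * c3) * \<rho> powr - (s * q) * \<theta> ^ i)" .
      qed (use nonneg \<theta> \<open>0 \<le> K\<close> in auto)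
      then show ?thesis by simp
    qed
    have "(\<integral>\<^sup>+ y. ennreal (\<bar>ln (e x) - ln (e y)\<bar> powr q / norm (x - y) powr a) \<partial>lborel)
        \<le> (\<integral>\<^sup>+ y. f1 y + f2 y + f3 y \<partial>lborel)"
      by (intro nn_integral_mono pw)
    also have "\<dots> = (\<integral>\<^sup>+ y. f1 y \<partial>lborel) + (\<integral>\<^sup>+ y. f2 y \<partial>lborel) + (\<integral>\<^sup>+ y. f3 y \<partial>lborel)"
      by (simp add: nn_integral_add)
    also have "\<dots> \<le> ennreal (c1 * \<rho> powr - (s * q)) + ennreal (L1 * (unit_ball_vol n * c2) * \<rho> powr - (s * q))
        + ennreal (L2 * (2 powr (1 / 2) * K * 4 * c3) / (1 - \<theta>) * \<rho> powr - (s * q))"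
      by (intro add_mono 1 2 3)
    also have "\<dots> = ennreal (c1 * \<rho> powr - (s * q) + L1 * (unit_ball_vol n * c2) * \<rho> powr - (s * q)
        + L2 * (2 powr (1 / 2) * K * 4 * c3) / (1 - \<theta>) * \<rho> powr - (s * q))"
      using nonneg \<theta> \<open>0 \<le> K\<close> by (simp flip: ennreal_plus)
    also have "c1 * \<rho> powr - (s * q) + L1 * (unit_ball_vol n * c2) * \<rho> powr - (s * q)
        + L2 * (2 powr (1 / 2) * K * 4 * c3) / (1 - \<theta>) * \<rho> powr - (s * q) = C * e x powr - (s * q)"
    proof -
      have "\<rho> powr - (s * q) = 2 powr (s * q) * e x powr - (s * q)"
        using \<rho> by (simp add: powr_mult powr_minus)
      then show ?thesis unfolding C_def by (simp only: algebra_simps)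
    qed
    finally show "(\<integral>\<^sup>+ y. ennreal (\<bar>ln (e x) - ln (e y)\<bar> powr q / norm (x - y) powr (n + s * q)) \<partial>lborel)
            \<le> ennreal (C * e x powr - (s * q))"
      unfolding a_def .
  qed
qed

section \<open>The energy\<close>

lemma ennreal_powr_le:
  assumes "x \<le> ennreal y" "0 \<le> y" "0 \<le> a"
  shows "ennreal_powr x a \<le> ennreal (y powr a)"
proof -
  have "x \<noteq> \<infinity>" using assms(1) by (auto simp: top_unique)
  moreover have "enn2real x \<le> y" using assms by (intro enn2real_leI)
  ultimately show ?thesis
    using assms by (auto simp: ennreal_powr_def intro!: ennreal_leI powr_mono2)
qed

text \<open>The inner integral of the seminorm, taken with respect to the Borel measure \<open>lborel\<close> so that
product measurability is available. The completion gives the same value.\<close>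
definition gagliardo :: "real \<Rightarrow> real \<Rightarrow> ('a::euclidean_space \<Rightarrow> real) \<Rightarrow> 'a \<Rightarrow> ennreal" where
  "gagliardo s q u x =
     (\<integral>\<^sup>+ y. ennreal (\<bar>u x - u y\<bar> powr q / norm (x - y) powr (real DIM('a) + s * q)) \<partial>lborel)"

definition energy :: "real \<Rightarrow> real \<Rightarrow> real \<Rightarrow> ('a::euclidean_space \<Rightarrow> real) \<Rightarrow> ennreal" where
  "energy s p q u = (\<integral>\<^sup>+ x. ennreal_powr (gagliardo s q u x) (p / q) \<partial>lborel)"

section \<open>Logarithmic bumps around a hypersurface\<close>

text \<open>The function \<open>d\<close> stands for the distance to a compact hypersurface \<open>{x. d x = 0}\<close>. The
assumption \<open>dens\<close> expresses codimension one: a \<open>t\<close>-neighbourhood has, in a ball of radius \<open>r\<close>,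
at most the volume of a slab of thickness \<open>t\<close>.\<close>
locale codim_one_layer =
  fixes d :: "'a::euclidean_space \<Rightarrow> real" and K R :: real
  assumes nonneg: "0 \<le> d x"
    and lip: "\<bar>d x - d y\<bar> \<le> norm (x - y)"
    and K: "0 \<le> K"
    and dens: "\<lbrakk>0 < t; 0 < r\<rbrakk> \<Longrightarrow>
      emeasure lborel ({y. d y < t} \<inter> ball x r) \<le> ennreal (K * t * r powr (real DIM('a) - 1))"
    and R: "0 < R"
    and supp: "d x < 1 \<Longrightarrow> norm x < R"
begin

text \<open>The logarithm of \<open>1 / d\<close>, stopped at depth \<open>2 powr - N\<close> and normalised to have the value one on the
hypersurface. The shift by \<open>1 / 2 ^ N\<close> makes the argument of the logarithm positive and keeps it Lipschitz,
and its sublevel sets are contained in those of \<open>d\<close>.\<close>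
definition bump :: "nat \<Rightarrow> 'a \<Rightarrow> real" where
  "bump N x = max 0 (- ln (d x + 1 / 2 ^ N) / (real N * ln 2))"

lemma continuous_d: "continuous_on UNIV d"
  using lip by (intro lipschitz_on_continuous_on[of 1] lipschitz_onI) (auto simp: dist_real_def dist_norm)

lemma borel_d [measurable]: "d \<in> borel_measurable borel"
  using continuous_d by (rule borel_measurable_continuous_onI)

lemma shift_pos: "0 < d x + 1 / 2 ^ N"
  using nonneg[of x] by (simp add: add_nonneg_pos)

lemma continuous_bump: "continuous_on UNIV (bump N)"
proof (cases "N = 0")
  case True
  then show ?thesis by (simp add: bump_def continuous_on_const)
next
  case False
  then show ?thesis
    unfolding bump_def using shift_pos[of _ N]
    by (intro continuous_intros continuous_d) (auto simp: less_imp_neq[symmetric])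
qed

lemma bump_nonneg: "0 \<le> bump N x"
  by (simp add: bump_def)

lemma bump_le_1: "bump N x \<le> 1"
proof (cases "N = 0")
  case False
  have "1 / 2 ^ N \<le> d x + 1 / 2 ^ N" using nonneg[of x] by simp
  then have "ln (1 / 2 ^ N) \<le> ln (d x + 1 / 2 ^ N)"
    using shift_pos[of x N] by (subst ln_le_cancel_iff) auto
  then have "- ln (d x + 1 / 2 ^ N) \<le> real N * ln 2"
    by (simp add: ln_div ln_realpow)
  then have "- ln (d x + 1 / 2 ^ N) / (real N * ln 2) \<le> 1"
    using False by (subst divide_le_eq_1_pos) auto
  then show ?thesis unfolding bump_def by (intro max.boundedI) auto
qed (simp add: bump_def)

lemma bump_eq_1: "bump N x = 1" if "d x = 0" "1 \<le> N"
  using that by (simp add: bump_def ln_div ln_realpow)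

lemma bump_eq_0: "bump N x = 0" if "1 \<le> d x"
proof -
  have "0 \<le> ln (d x + 1 / 2 ^ N)" using that by (intro ln_ge_zero) (simp add: add_increasing2)
  then show ?thesis by (simp add: bump_def divide_nonpos_nonneg)
qed

text \<open>The number of dyadic layers that contain \<open>x\<close> measures the logarithm of \<open>1 / (d x + 1 / 2 ^ N)\<close>,
and there are at most \<open>N + 1\<close> of them.\<close>
lemma dyadic_layers:
  assumes "d x + 1 / 2 ^ N < 1"
  obtains i where "i \<le> N" "1 / (d x + 1 / 2 ^ N) < 2 ^ (i + 1)" "\<And>j. j \<le> i \<Longrightarrow> d x < 1 / 2 ^ j"
proof -
  define e where "e = d x + 1 / 2 ^ N"
  have e: "0 < e" "e < 1" "d x < e" "1 / 2 ^ N \<le> e"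
    using shift_pos[of x N] assms nonneg[of x] by (auto simp: e_def)
  then have "1 \<le> 1 / e" by simp
  then obtain i where i: "2 ^ i \<le> 1 / e" "1 / e < 2 ^ (i + 1)" by (rule dyadic_bracket)
  show thesis
  proof (rule that)
    have "1 / e \<le> 2 ^ N" using e by (simp add: field_simps)
    with i(1) have "(2::real) ^ i \<le> 2 ^ N" by linarith
    then show "i \<le> N" by simp
    show "1 / (d x + 1 / 2 ^ N) < 2 ^ (i + 1)" using i(2) by (simp add: e_def)
    fix j assume "j \<le> i"
    then have "(2::real) ^ j \<le> 2 ^ i" by simp
    with i(1) have "2 ^ j \<le> 1 / e" by linarith
    then have "e \<le> 1 / 2 ^ j" using e by (simp add: field_simps)
    then show "d x < 1 / 2 ^ j" using e by linarith
  qed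
qed

text \<open>The ball contains the support of the bumps and is twice as large, so that a point outside it is
at least half its norm away from the support.\<close>
definition layer :: "nat \<Rightarrow> 'a set" where
  "layer i = {y. d y < 1 / 2 ^ i} \<inter> ball 0 (2 * R)"

lemma layer_borel [measurable]: "layer i \<in> sets borel"
proof -
  have "{y. d y < 1 / 2 ^ i} \<in> sets borel" by measurable
  then show ?thesis unfolding layer_def by (intro sets.Int) auto
qed

definition layer_const :: real where
  "layer_const = K * (2 * R) powr (real DIM('a) - 1)"

lemma layer_const_nonneg: "0 \<le> layer_const"
  using K by (simp add: layer_const_def)

lemma emeasure_layer: "emeasure lborel (layer i) \<le> ennreal (layer_const / 2 ^ i)"
  using dens[of "1 / 2 ^ i" "2 * R" 0] R by (simp add: layer_def layer_const_def mult_ac)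

text \<open>The bump is at most \<open>1 / N\<close> times the number of layers around the point, and the volumes of the
layers are summable: only the normalisation by \<open>N\<close> remains.\<close>
lemma nn_integral_bump:
  assumes "1 \<le> N"
  shows "(\<integral>\<^sup>+ x. ennreal (bump N x) \<partial>lborel) \<le> ennreal (2 * layer_const / real N)"
proof -
  have pw: "ennreal (bump N x) \<le> (\<Sum>i\<le>N. ennreal (1 / real N) * indicator (layer i) x)" for x
  proof (cases "d x + 1 / 2 ^ N < 1")
    case False
    then have "0 \<le> ln (d x + 1 / 2 ^ N)" by (intro ln_ge_zero) auto
    then have "bump N x = 0" by (simp add: bump_def divide_nonpos_nonneg)
    then show ?thesis by simp
  next
    case True
    then obtain i where i: "i \<le> N" "1 / (d x + 1 / 2 ^ N) < 2 ^ (i + 1)" "\<And>j. j \<le> i \<Longrightarrow> d x < 1 / 2 ^ j"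
      by (rule dyadic_layers) blast
    have "d x < 1" using i(3)[of 0] by simp
    then have x: "x \<in> ball 0 (2 * R)" using supp[of x] R by simp
    have "ln (1 / (d x + 1 / 2 ^ N)) \<le> ln (2 ^ (i + 1))"
      using i(2) shift_pos[of x N] by (intro ln_mono) auto
    then have "- ln (d x + 1 / 2 ^ N) \<le> real (i + 1) * ln 2"
      using shift_pos[of x N] by (simp only: ln_div ln_one ln_realpow zero_less_one) simp
    then have "- ln (d x + 1 / 2 ^ N) / (real N * ln 2) \<le> real (i + 1) * ln 2 / (real N * ln 2)"
      by (intro divide_right_mono) auto
    also have "\<dots> = (\<Sum>j\<le>i. 1 / real N)" by simp
    finally have "bump N x \<le> (\<Sum>j\<le>i. 1 / real N)"
      by (simp add: bump_def)
    also have "\<dots> = (\<Sum>j\<le>i. 1 / real N * indicator (layer j) x)"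
      using i(3) x by (intro sum.cong) (auto simp: layer_def)
    also have "\<dots> \<le> (\<Sum>j\<le>N. 1 / real N * indicator (layer j) x)"
      using i(1) by (intro sum_mono2) auto
    finally have "ennreal (bump N x) \<le> ennreal (\<Sum>j\<le>N. 1 / real N * indicator (layer j) x)"
      by (rule ennreal_leI)
    also have "\<dots> = (\<Sum>j\<le>N. ennreal (1 / real N) * indicator (layer j) x)"
      by (subst sum_ennreal[symmetric], simp, intro sum.cong refl) (simp split: split_indicator)
    finally show ?thesis .
  qed
  have "(\<integral>\<^sup>+ x. ennreal (bump N x) \<partial>lborel)
      \<le> (\<integral>\<^sup>+ x. (\<Sum>i\<le>N. ennreal (1 / real N) * indicator (layer i) x) \<partial>lborel)"
    by (intro nn_integral_mono pw)
  also have "\<dots> = (\<Sum>i\<le>N. ennreal (1 / real N) * emeasure lborel (layer i))"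
    by (subst nn_integral_sum) (auto simp: nn_integral_cmult_indicator)
  also have "\<dots> \<le> (\<Sum>i\<le>N. ennreal (1 / real N) * ennreal (layer_const / 2 ^ i))"
    by (intro sum_mono mult_left_mono emeasure_layer) auto
  also have "\<dots> = ennreal (\<Sum>i\<le>N. 1 / real N * (layer_const / 2 ^ i))"
    using layer_const_nonneg by (simp add: ennreal_mult'[symmetric] sum_ennreal)
  also have "(\<Sum>i\<le>N. 1 / real N * (layer_const / 2 ^ i)) = layer_const / real N * (\<Sum>i\<le>N. (1 / 2) ^ i)"
    by (simp add: sum_distrib_left power_one_over)
  also have "ennreal (layer_const / real N * (\<Sum>i\<le>N. (1 / 2) ^ i)) \<le> ennreal (layer_const / real N * 2)"
  proof (intro ennreal_leI mult_left_mono)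
    have "(\<Sum>i\<le>N. (1 / 2 :: real) ^ i) = 2 - (1 / 2) ^ N" by (induction N) auto
    then show "(\<Sum>i\<le>N. (1 / 2 :: real) ^ i) \<le> 2" by simp
  qed (use layer_const_nonneg in simp)
  finally show ?thesis by (simp add: mult.commute)
qed

text \<open>The critical integral: \<open>1 / d\<close> has the same mass on each dyadic layer, and so the divergence
is only logarithmic, that is, linear in \<open>N\<close>.\<close>
lemma nn_integral_inverse:
  assumes "1 \<le> N"
  shows "(\<integral>\<^sup>+ x. ennreal (1 / (d x + 1 / 2 ^ N)) * indicator (ball 0 (2 * R)) x \<partial>lborel)
      \<le> ennreal (real N * (unit_ball_vol (real DIM('a)) * (2 * R) powr real DIM('a) + 4 * layer_const))"
proof -
  define V where "V = unit_ball_vol (real DIM('a)) * (2 * R) powr real DIM('a)"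
  have V: "0 \<le> V" by (simp add: V_def)
  have pw: "ennreal (1 / (d x + 1 / 2 ^ N)) * indicator (ball 0 (2 * R)) x
      \<le> indicator (ball 0 (2 * R)) x + (\<Sum>i\<le>N. ennreal (2 ^ (i + 1)) * indicator (layer i) x)" for x
  proof (cases "x \<in> ball 0 (2 * R)")
    case x: True
    show ?thesis
    proof (cases "d x + 1 / 2 ^ N < 1")
      case False
      then have "1 / (d x + 1 / 2 ^ N) \<le> 1" by (simp add: divide_le_eq)
      then have "ennreal (1 / (d x + 1 / 2 ^ N)) \<le> 1" by (simp add: ennreal_le_1)
      then show ?thesis using x by (simp add: add_increasing2)
    next
      case True
      then obtain i where i: "i \<le> N" "1 / (d x + 1 / 2 ^ N) < 2 ^ (i + 1)" "\<And>j. j \<le> i \<Longrightarrow> d x < 1 / 2 ^ j"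
        by (rule dyadic_layers) blast
      have "x \<in> layer i" using i(3)[of i] x by (simp add: layer_def)
      have "ennreal (1 / (d x + 1 / 2 ^ N)) \<le> ennreal (2 ^ (i + 1))"
        using i(2) by (intro ennreal_leI) simp
      also have "\<dots> = ennreal (2 ^ (i + 1)) * indicator (layer i) x"
        using \<open>x \<in> layer i\<close> by simp
      also have "\<dots> \<le> (\<Sum>i\<le>N. ennreal (2 ^ (i + 1)) * indicator (layer i) x)"
        using i(1) by (intro member_le_sum) auto
      finally show ?thesis using x by (simp add: add_increasing)
    qed
  qed simp
  have "(\<integral>\<^sup>+ x. ennreal (1 / (d x + 1 / 2 ^ N)) * indicator (ball 0 (2 * R)) x \<partial>lborel)
      \<le> (\<integral>\<^sup>+ x. indicator (ball 0 (2 * R)) x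
            + (\<Sum>i\<le>N. ennreal (2 ^ (i + 1)) * indicator (layer i) x) \<partial>lborel)"
    by (intro nn_integral_mono pw)
  also have "\<dots> = (\<integral>\<^sup>+ x. indicator (ball (0::'a) (2 * R)) x \<partial>lborel)
      + (\<integral>\<^sup>+ x. (\<Sum>i\<le>N. ennreal (2 ^ (i + 1)) * indicator (layer i) x) \<partial>lborel)"
    by (intro nn_integral_add borel_measurable_sum borel_measurable_times_ennreal borel_measurable_indicator) auto
  also have "(\<integral>\<^sup>+ x. (\<Sum>i\<le>N. ennreal (2 ^ (i + 1)) * indicator (layer i) x) \<partial>lborel)
      = (\<Sum>i\<le>N. \<integral>\<^sup>+ x. ennreal (2 ^ (i + 1)) * indicator (layer i) x \<partial>lborel)"
    by (intro nn_integral_sum borel_measurable_times_ennreal borel_measurable_indicator) auto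
  also have "\<dots> = (\<Sum>i\<le>N. ennreal (2 ^ (i + 1)) * emeasure lborel (layer i))"
    by (intro sum.cong refl nn_integral_cmult_indicator) auto
  also have "(\<integral>\<^sup>+ x. indicator (ball (0::'a) (2 * R)) x \<partial>lborel) = emeasure lborel (ball (0::'a) (2 * R))"
    by (intro nn_integral_indicator) auto
  also have "emeasure lborel (ball (0::'a) (2 * R)) + (\<Sum>i\<le>N. ennreal (2 ^ (i + 1)) * emeasure lborel (layer i))
      \<le> ennreal V + (\<Sum>i\<le>N. ennreal (2 ^ (i + 1)) * ennreal (layer_const / 2 ^ i))"
    using R by (intro add_mono sum_mono mult_left_mono emeasure_layer) (auto simp: V_def emeasure_ball_powr)
  also have "(\<Sum>i\<le>N. ennreal (2 ^ (i + 1)) * ennreal (layer_const / 2 ^ i))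
      = (\<Sum>i\<le>N. ennreal (2 ^ (i + 1) * (layer_const / 2 ^ i)))"
    by (intro sum.cong refl ennreal_mult'[symmetric]) simp
  also have "\<dots> = ennreal (\<Sum>i\<le>N. 2 ^ (i + 1) * (layer_const / 2 ^ i))"
    using layer_const_nonneg by (intro sum_ennreal) simp
  also have "ennreal V + \<dots> = ennreal (V + (\<Sum>i\<le>N. 2 ^ (i + 1) * (layer_const / 2 ^ i)))"
    using layer_const_nonneg V by (intro ennreal_plus[symmetric] sum_nonneg) auto
  also have "(\<Sum>i\<le>N. 2 ^ (i + 1) * (layer_const / 2 ^ i)) = (real N + 1) * (2 * layer_const)"
    by simp
  also have "ennreal (V + (real N + 1) * (2 * layer_const)) \<le> ennreal (real N * (V + 4 * layer_const))"
  proof (rule ennreal_leI)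
    have "1 * V \<le> real N * V" "1 * layer_const \<le> real N * layer_const"
      using assms V layer_const_nonneg by (intro mult_right_mono; simp)+
    then show "V + (real N + 1) * (2 * layer_const) \<le> real N * (V + 4 * layer_const)"
      by (simp add: algebra_simps)
  qed
  finally show ?thesis by (simp add: V_def)
qed


lemma bump_increment:
  assumes "1 \<le> N"
  shows "\<bar>bump N x - bump N y\<bar> \<le> \<bar>ln (d x + 1 / 2 ^ N) - ln (d y + 1 / 2 ^ N)\<bar> / (real N * ln 2)"
proof -
  have "\<bar>max 0 (- a / c) - max 0 (- b / c)\<bar> \<le> \<bar>a - b\<bar> / c" if "0 < c" for a b c :: real
  proof -
    have "\<bar>max 0 (- v) - max 0 (- w)\<bar> \<le> \<bar>v - w\<bar>" for v w :: real by linarith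
    from this[of "a / c" "b / c"]
    have "\<bar>max 0 (- a / c) - max 0 (- b / c)\<bar> \<le> \<bar>a / c - b / c\<bar>" by simp
    also have "\<dots> = \<bar>a - b\<bar> / c" using that by (simp add: diff_divide_distrib[symmetric])
    finally show ?thesis .
  qed
  then show ?thesis unfolding bump_def using assms by simp
qed

lemma gagliardo_bump_near:
  fixes s q :: real
  assumes "0 < s" "s < 1" "1 \<le> q"
  obtains C where "0 \<le> C"
    and "\<And>N x. 1 \<le> N \<Longrightarrow> gagliardo s q (bump N) x
           \<le> ennreal ((real N * ln 2) powr - q * (C * (d x + 1 / 2 ^ N) powr - (s * q)))"
proof -
  obtain C where C: "0 \<le> C"
    and bd: "\<And>(e :: 'a \<Rightarrow> real) x.
      \<lbrakk>\<And>x. 0 < e x; \<And>x y. \<bar>e x - e y\<bar> \<le> norm (x - y);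
       \<And>x t r. \<lbrakk>0 < t; 0 < r\<rbrakk> \<Longrightarrow>
         emeasure lborel ({y. e y < t} \<inter> ball x r) \<le> ennreal (K * t * r powr (real DIM('a) - 1))\<rbrakk>
      \<Longrightarrow> (\<integral>\<^sup>+ y. ennreal (\<bar>ln (e x) - ln (e y)\<bar> powr q / norm (x - y) powr (real DIM('a) + s * q)) \<partial>lborel)
            \<le> ennreal (C * e x powr - (s * q))"
    by (rule nn_integral_ln_increment[OF K assms, where 'a = 'a]) blast
  show thesis
  proof (rule that[OF C])
    fix N :: nat and x
    assume N: "1 \<le> N"
    define c where "c = real N * ln 2"
    have c: "0 < c" using N by (simp add: c_def)
    define e where "e x = d x + 1 / 2 ^ N" for x
    define a where "a = real DIM('a) + s * q"
    have [measurable]: "e \<in> borel_measurable borel" unfolding e_def by measurable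
    have sub: "{y. e y < t} \<subseteq> {y. d y < t}" for t unfolding e_def
      by (auto intro: less_trans[rotated])
    have meas: "{y. d y < t} \<inter> ball z r \<in> sets lborel" for t z r
    proof -
      have "{y. d y < t} \<in> sets borel" by measurable
      then show ?thesis by auto
    qed
    have "gagliardo s q (bump N) x \<le> (\<integral>\<^sup>+ y. ennreal (c powr - q) *
        ennreal (\<bar>ln (e x) - ln (e y)\<bar> powr q / norm (x - y) powr a) \<partial>lborel)"
      unfolding gagliardo_def a_def[symmetric]
    proof (rule nn_integral_mono)
      fix y
      have "\<bar>bump N x - bump N y\<bar> powr q \<le> (\<bar>ln (e x) - ln (e y)\<bar> / c) powr q"
        using bump_increment[OF N, of x y] \<open>1 \<le> q\<close>
        by (intro powr_mono2) (auto simp: e_def c_def)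
      also have "\<dots> = c powr - q * \<bar>ln (e x) - ln (e y)\<bar> powr q"
        using c by (simp add: powr_divide powr_minus_divide)
      finally have "\<bar>bump N x - bump N y\<bar> powr q / norm (x - y) powr a
          \<le> c powr - q * \<bar>ln (e x) - ln (e y)\<bar> powr q / norm (x - y) powr a"
        by (rule divide_right_mono) simp
      then show "ennreal (\<bar>bump N x - bump N y\<bar> powr q / norm (x - y) powr a)
          \<le> ennreal (c powr - q) * ennreal (\<bar>ln (e x) - ln (e y)\<bar> powr q / norm (x - y) powr a)"
        by (subst ennreal_mult'[symmetric]) (auto intro: ennreal_leI)
    qed
    also have "\<dots> = ennreal (c powr - q) *
        (\<integral>\<^sup>+ y. ennreal (\<bar>ln (e x) - ln (e y)\<bar> powr q / norm (x - y) powr a) \<partial>lborel)"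
      by (rule nn_integral_cmult) measurable
    also have "\<dots> \<le> ennreal (c powr - q) * ennreal (C * e x powr - (s * q))"
      unfolding a_def
    proof (intro mult_left_mono bd)
      show "0 < e z" for z using shift_pos[of z N] by (simp add: e_def)
      show "\<bar>e z - e y\<bar> \<le> norm (z - y)" for z y using lip by (simp add: e_def)
      show "emeasure lborel ({y. e y < t} \<inter> ball z r) \<le> ennreal (K * t * r powr (real DIM('a) - 1))"
        if "0 < t" "0 < r" for z t r
        using emeasure_mono[OF _ meas, of "{y. e y < t} \<inter> ball z r" t z r] sub[of t] dens[OF that, of z]
        by (auto intro: order_trans)
    qed simp
    also have "\<dots> = ennreal (c powr - q * (C * e x powr - (s * q)))"
      by (rule ennreal_mult'[symmetric]) simp
    finally show "gagliardo s q (bump N) x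
           \<le> ennreal ((real N * ln 2) powr - q * (C * (d x + 1 / 2 ^ N) powr - (s * q)))"
      by (simp add: c_def e_def)
  qed
qed

text \<open>Far from the support the integral sees the bump as a point mass of size \<open>1 / N\<close>. This bound
keeps the full decay of the kernel, which \<open>gagliardo_bump_near\<close> cannot show, since it rests on
\<open>dens\<close> alone and so would also hold for an unbounded hypersurface. The power \<open>q\<close> is removed by \<open>bump N y \<le> 1\<close>.\<close>
lemma gagliardo_bump_far:
  fixes s q :: real
  assumes "0 < s" "1 \<le> q" "1 \<le> N" "2 * R \<le> norm x"
  shows "gagliardo s q (bump N) x
    \<le> ennreal ((norm x / 2) powr - (real DIM('a) + s * q) * (2 * layer_const / real N))"
proof -
  define a where "a = real DIM('a) + s * q"
  have a: "0 < a" using assms by (auto simp: a_def intro: add_nonneg_pos)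
  have x0: "bump N x = 0" using supp[of x] assms(4) R bump_eq_0[of x N] by linarith
  have "gagliardo s q (bump N) x
      \<le> (\<integral>\<^sup>+ y. ennreal ((norm x / 2) powr - a) * ennreal (bump N y) \<partial>lborel)"
    unfolding gagliardo_def a_def[symmetric]
  proof (rule nn_integral_mono)
    fix y
    show "ennreal (\<bar>bump N x - bump N y\<bar> powr q / norm (x - y) powr a)
        \<le> ennreal ((norm x / 2) powr - a) * ennreal (bump N y)"
    proof (cases "bump N y = 0")
      case False
      then have "norm y < R" using bump_eq_0[of y N] supp[of y] by linarith
      then have xy: "norm x / 2 \<le> norm (x - y)" "0 < norm x"
        using norm_triangle_sub[of x y] assms(4) R by linarith+
      have pos: "0 < bump N y" using False bump_nonneg[of N y] by linarith
      have "bump N y powr q \<le> bump N y powr 1"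
        using bump_le_1[of N y] pos \<open>1 \<le> q\<close> by (intro powr_mono') auto
      then have "\<bar>bump N x - bump N y\<bar> powr q \<le> bump N y" using x0 pos by simp
      moreover have "norm (x - y) powr - a \<le> (norm x / 2) powr - a"
        using xy a by (intro powr_mono2') auto
      ultimately have "norm (x - y) powr - a * \<bar>bump N x - bump N y\<bar> powr q
          \<le> (norm x / 2) powr - a * bump N y"
        by (intro mult_mono) auto
      then show ?thesis
        by (subst ennreal_mult'[symmetric]) (auto intro!: ennreal_leI simp: powr_minus_divide)
    qed (use x0 in simp)
  qed
  also have "\<dots> = ennreal ((norm x / 2) powr - a) * (\<integral>\<^sup>+ y. ennreal (bump N y) \<partial>lborel)"
    using borel_measurable_continuous_onI[OF continuous_bump[of N]]
    by (intro nn_integral_cmult) auto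
  also have "\<dots> \<le> ennreal ((norm x / 2) powr - a) * ennreal (2 * layer_const / real N)"
    using assms by (intro mult_left_mono nn_integral_bump) auto
  also have "\<dots> = ennreal ((norm x / 2) powr - a * (2 * layer_const / real N))"
    by (rule ennreal_mult'[symmetric]) simp
  finally show ?thesis by (simp add: a_def)
qed

text \<open>Inside the ball, the power \<open>p / q\<close> of \<open>gagliardo_bump_near\<close> is \<open>N powr - p\<close> times \<open>1 / d\<close>,
because \<open>s * p = 1\<close>, and the integral of \<open>1 / d\<close> is only of order \<open>N\<close>. Outside, \<open>gagliardo_bump_far\<close> leaves
the power \<open>(DIM + s * q) * (p / q)\<close> of \<open>1 / norm x\<close>, which is integrable at infinity exactly when this
exponent exceeds the dimension. For \<open>p > 1\<close> both contributions vanish as \<open>N\<close> grows: the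
hypersurface has zero capacity.\<close>
theorem energy_bump_le:
  fixes s p q :: real
  assumes "0 < s" "s < 1" "0 < p" "s * p = 1" "1 \<le> q"
    and int: "real DIM('a) < (real DIM('a) + s * q) * (p / q)"
  obtains C where "0 \<le> C"
    "\<And>N. 1 \<le> N \<Longrightarrow> energy s p q (bump N) \<le> ennreal (C * (real N powr (1 - p) + real N powr - (p / q)))"
proof -
  define n where "n = real DIM('a)"
  define a where "a = n + s * q"
  define b where "b = a * (p / q)"
  have a: "0 < a" using assms by (auto simp: a_def n_def intro: add_nonneg_pos)
  have nb: "n < b" using int by (simp add: a_def b_def n_def)
  have pq: "0 < p / q" "s * q * (p / q) = 1" using assms by auto
  obtain C0 where C0: "0 \<le> C0"
    and near: "\<And>N x. 1 \<le> N \<Longrightarrow> gagliardo s q (bump N) x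
           \<le> ennreal ((real N * ln 2) powr - q * (C0 * (d x + 1 / 2 ^ N) powr - (s * q)))"
    by (rule gagliardo_bump_near[OF assms(1,2,5)]) blast
  define C1 where "C1 = unit_ball_vol n * (2 * R) powr n + 4 * layer_const"
  define A where "A = ln 2 powr - p * C0 powr (p / q) * C1"
  define c where "c = unit_ball_vol n * (2 * R) powr (n - b) * (2 powr n / (1 - 2 powr (n - b)))"
  define B where "B = 2 powr b * (2 * layer_const) powr (p / q) * c"
  have c: "0 \<le> c" unfolding c_def using powr_less_cancel_iff[of 2 "n - b" 0] nb by (simp add: n_def)
  have C1: "0 \<le> C1" unfolding C1_def using layer_const_nonneg by (simp add: n_def)
  have A: "0 \<le> A" unfolding A_def using C1 by simp
  have B: "0 \<le> B" unfolding B_def using c by simp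
  show thesis
  proof (rule that[of "A + B"])
    show "0 \<le> A + B" using A B by simp
  next
    fix N :: nat
    assume N: "1 \<le> N"
    \<comment> \<open>The majorants inside and outside the ball.\<close>
    define f1 where "f1 x = ennreal ((real N * ln 2) powr - p * C0 powr (p / q)) *
      (ennreal (1 / (d x + 1 / 2 ^ N)) * indicator (ball 0 (2 * R)) x)" for x
    define f2 where "f2 x = ennreal (2 powr b * (2 * layer_const / real N) powr (p / q)) *
      (ennreal (norm (0 - x) powr - b) * indicator {x \<in> UNIV. 2 * R \<le> norm (0 - x)} x)" for x :: 'a
    have pw: "ennreal_powr (gagliardo s q (bump N) x) (p / q) \<le> f1 x + f2 x" for x
    proof (cases "norm x < 2 * R")
      case True
      have e: "0 < d x + 1 / 2 ^ N" by (rule shift_pos)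
      have "ennreal_powr (gagliardo s q (bump N) x) (p / q)
          \<le> ennreal (((real N * ln 2) powr - q * (C0 * (d x + 1 / 2 ^ N) powr - (s * q))) powr (p / q))"
        using C0 pq by (intro ennreal_powr_le near N) auto
      also have "((real N * ln 2) powr - q * (C0 * (d x + 1 / 2 ^ N) powr - (s * q))) powr (p / q)
          = (real N * ln 2) powr - p * C0 powr (p / q) * (d x + 1 / 2 ^ N) powr - 1"
      proof -
        have "- q * (p / q) = - p" "- (s * q) * (p / q) = - 1" using pq \<open>1 \<le> q\<close> by auto
        then show ?thesis
          using C0 by (simp only: powr_mult powr_powr powr_ge_zero mult_nonneg_nonneg mult.assoc)
      qed
      also have "ennreal \<dots> = f1 x"
        using True e C0 unfolding f1_def
        by (simp add: powr_minus_divide ennreal_mult'[symmetric])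
      finally show ?thesis by (simp add: add_increasing2)
    next
      case False
      then have x: "2 * R \<le> norm x" "0 < norm x" using R by auto
      have "ennreal_powr (gagliardo s q (bump N) x) (p / q)
          \<le> ennreal (((norm x / 2) powr - a * (2 * layer_const / real N)) powr (p / q))"
        using layer_const_nonneg pq gagliardo_bump_far[OF assms(1,5) N x(1)]
        by (intro ennreal_powr_le) (auto simp: a_def n_def)
      also have "((norm x / 2) powr - a * (2 * layer_const / real N)) powr (p / q)
          = 2 powr b * (2 * layer_const / real N) powr (p / q) * norm x powr - b"
      proof -
        have "((norm x / 2) powr - a * (2 * layer_const / real N)) powr (p / q)
            = (norm x / 2) powr - b * (2 * layer_const / real N) powr (p / q)"
          using layer_const_nonneg by (subst powr_mult) (auto simp: powr_powr b_def)
        also have "(norm x / 2) powr - b = 2 powr b * norm x powr - b"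
          using x by (simp add: powr_divide powr_minus_divide)
        finally show ?thesis by (simp only: mult_ac)
      qed
      also have "ennreal \<dots> = f2 x"
        using x unfolding f2_def by (simp add: ennreal_mult'[symmetric])
      finally show ?thesis by (simp add: add_increasing)
    qed
    have [measurable]: "f1 \<in> borel_measurable borel"
      unfolding f1_def by (intro borel_measurable_times_ennreal borel_measurable_indicator) auto
    have [measurable]: "f2 \<in> borel_measurable borel"
      unfolding f2_def by measurable
    have 1: "(\<integral>\<^sup>+ x. f1 x \<partial>lborel) \<le> ennreal (A * real N powr (1 - p))"
    proof -
      have "(\<integral>\<^sup>+ x. f1 x \<partial>lborel) = ennreal ((real N * ln 2) powr - p * C0 powr (p / q)) *
          (\<integral>\<^sup>+ x. ennreal (1 / (d x + 1 / 2 ^ N)) * indicator (ball 0 (2 * R)) x \<partial>lborel)"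
        unfolding f1_def
        by (intro nn_integral_cmult borel_measurable_times_ennreal borel_measurable_indicator) auto
      also have "\<dots> \<le> ennreal ((real N * ln 2) powr - p * C0 powr (p / q)) * ennreal (real N * C1)"
        unfolding C1_def n_def by (intro mult_left_mono nn_integral_inverse N) auto
      also have "\<dots> = ennreal ((real N * ln 2) powr - p * C0 powr (p / q) * (real N * C1))"
        by (intro ennreal_mult'[symmetric]) auto
      also have "(real N * ln 2) powr - p * C0 powr (p / q) * (real N * C1) = A * real N powr (1 - p)"
      proof -
        have "(real N * ln 2) powr - p = real N powr - p * ln 2 powr - p"
          by (subst powr_mult) auto
        moreover have "real N powr (1 - p) = real N * real N powr - p"
          using N by (simp add: powr_diff powr_minus_divide)
        ultimately show ?thesis unfolding A_def by (simp only: mult_ac)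
      qed
      finally show ?thesis .
    qed
    have 2: "(\<integral>\<^sup>+ x. f2 x \<partial>lborel) \<le> ennreal (B * real N powr - (p / q))"
    proof -
      have "(\<integral>\<^sup>+ x. f2 x \<partial>lborel) = ennreal (2 powr b * (2 * layer_const / real N) powr (p / q)) *
          (\<integral>\<^sup>+ x. ennreal (norm (0 - x) powr - b) * indicator {x \<in> UNIV. 2 * R \<le> norm (0 - x :: 'a)} x \<partial>lborel)"
        unfolding f2_def by (intro nn_integral_cmult) measurable
      also have "\<dots> \<le> ennreal (2 powr b * (2 * layer_const / real N) powr (p / q)) * ennreal c"
        unfolding c_def using R nb a pq
        by (intro mult_left_mono nn_integral_kernel_tail) (auto simp: n_def emeasure_ball_powr b_def)
      also have "\<dots> = ennreal (2 powr b * (2 * layer_const / real N) powr (p / q) * c)"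
        by (intro ennreal_mult'[symmetric]) auto
      also have "2 powr b * (2 * layer_const / real N) powr (p / q) * c = B * real N powr - (p / q)"
      proof -
        have "(2 * layer_const / real N) powr (p / q) = (2 * layer_const) powr (p / q) * real N powr - (p / q)"
          using layer_const_nonneg by (simp add: powr_divide powr_minus_divide)
        then show ?thesis unfolding B_def by (simp only: mult_ac)
      qed
      finally show ?thesis .
    qed
    have "energy s p q (bump N) \<le> (\<integral>\<^sup>+ x. f1 x + f2 x \<partial>lborel)"
      unfolding energy_def by (intro nn_integral_mono pw)
    also have "\<dots> = (\<integral>\<^sup>+ x. f1 x \<partial>lborel) + (\<integral>\<^sup>+ x. f2 x \<partial>lborel)"
      by (rule nn_integral_add) auto
    also have "\<dots> \<le> ennreal (A * real N powr (1 - p)) + ennreal (B * real N powr - (p / q))"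
      by (intro add_mono 1 2)
    also have "\<dots> = ennreal (A * real N powr (1 - p) + B * real N powr - (p / q))"
      using A B by (intro ennreal_plus[symmetric]) auto
    also have "\<dots> \<le> ennreal ((A + B) * (real N powr (1 - p) + real N powr - (p / q)))"
      using A B by (intro ennreal_leI) (simp add: algebra_simps)
    finally show "energy s p q (bump N) \<le> ennreal ((A + B) * (real N powr (1 - p) + real N powr - (p / q)))" .
  qed
qed

end

section \<open>Surfaces of cubes have zero capacity\<close>

lemma emeasure_slab_box:
  fixes x b :: "'a::euclidean_space"
  assumes "b \<in> Basis" "0 < t" "0 < \<rho>"
  shows "emeasure lborel
      (cbox (\<Sum>c\<in>Basis. (if c = b then v - t else x \<bullet> c - \<rho>) *\<^sub>R c)
            (\<Sum>c\<in>Basis. (if c = b then v + t else x \<bullet> c + \<rho>) *\<^sub>R c))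
      = ennreal (2 * t * (2 * \<rho>) powr (real DIM('a) - 1))"
proof -
  let ?l = "\<Sum>c\<in>Basis. (if c = b then v - t else x \<bullet> c - \<rho>) *\<^sub>R c"
  let ?u = "\<Sum>c\<in>Basis. (if c = b then v + t else x \<bullet> c + \<rho>) *\<^sub>R c"
  have "emeasure lborel (cbox ?l ?u) = (\<Prod>c\<in>Basis. (?u - ?l) \<bullet> c)"
    using assms by (intro emeasure_lborel_cbox) (auto simp: inner_sum_left_Basis)
  also have "(\<Prod>c\<in>Basis. (?u - ?l) \<bullet> c) = (\<Prod>c\<in>Basis. if c = b then 2 * t else 2 * \<rho>)"
    by (intro prod.cong) (auto simp: inner_diff_left)
  also have "\<dots> = 2 * t * (\<Prod>c\<in>Basis - {b}. if c = b then 2 * t else 2 * \<rho>)"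
    using assms(1) by (subst prod.remove[of _ b]) auto
  also have "(\<Prod>c\<in>Basis - {b}. if c = b then 2 * t else 2 * \<rho>) = (\<Prod>c\<in>Basis - {b}. 2 * \<rho>)"
    by (intro prod.cong) auto
  also have "\<dots> = (2 * \<rho>) ^ (DIM('a) - 1)"
    using assms(1) by (simp add: card_Diff_singleton)
  also have "\<dots> = (2 * \<rho>) powr (real DIM('a) - 1)"
  proof -
    have "(2 * \<rho>) powr (real DIM('a) - 1) = (2 * \<rho>) powr real (DIM('a) - 1)"
      using DIM_positive[where 'a = 'a] by (simp add: of_nat_diff Suc_leI)
    also have "\<dots> = (2 * \<rho>) ^ (DIM('a) - 1)"
      using assms(3) by (intro powr_realpow) simp
    finally show ?thesis by simp
  qed
  finally show ?thesis .
qed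

text \<open>Spheres of the maximum norm are used because they are made of flat faces: a point of the shell
has a coordinate within \<open>t\<close> of \<open>r\<close> or \<open>- r\<close>, and so the part of the shell in a ball is covered by one flat
box for each coordinate and sign.\<close>
lemma emeasure_cube_shell:
  fixes x :: "'a::euclidean_space"
  assumes "0 < t" "0 < \<rho>"
  shows "emeasure lborel ({y. \<bar>infnorm y - r\<bar> < t} \<inter> ball x \<rho>)
      \<le> ennreal (4 * real DIM('a) * 2 powr (real DIM('a) - 1) * t * \<rho> powr (real DIM('a) - 1))"
proof -
  define Q where "Q b \<sigma> = cbox (\<Sum>c\<in>Basis. (if c = b then \<sigma> * r - t else x \<bullet> c - \<rho>) *\<^sub>R c)
            (\<Sum>c\<in>Basis. (if c = b then \<sigma> * r + t else x \<bullet> c + \<rho>) *\<^sub>R c)" for b :: 'a and \<sigma> :: real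
  have "{y. \<bar>infnorm y - r\<bar> < t} \<inter> ball x \<rho> \<subseteq> (\<Union>b\<in>Basis. \<Union>\<sigma>\<in>{1, -1}. Q b \<sigma>)"
  proof
    fix y assume y: "y \<in> {y. \<bar>infnorm y - r\<bar> < t} \<inter> ball x \<rho>"
    have "infnorm y \<in> (\<lambda>b. \<bar>y \<bullet> b\<bar>) ` Basis"
      unfolding infnorm_Max by (intro Max_in) auto
    then obtain b where b: "b \<in> Basis" "infnorm y = \<bar>y \<bullet> b\<bar>" by auto
    have near: "\<bar>y \<bullet> c - x \<bullet> c\<bar> \<le> \<rho>" if "c \<in> Basis" for c
      using Basis_le_norm[OF that, of "y - x"] y by (simp add: dist_norm norm_minus_commute inner_diff_left)
    define \<sigma> :: real where "\<sigma> = (if 0 \<le> y \<bullet> b then 1 else -1)"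
    have "\<bar>y \<bullet> b - \<sigma> * r\<bar> < t" using y b by (auto simp: \<sigma>_def abs_if split: if_splits)
    then have "y \<in> Q b \<sigma>"
      using near unfolding Q_def mem_box by (fastforce simp: abs_le_iff abs_less_iff)
    moreover have "\<sigma> \<in> {1, -1}" by (simp add: \<sigma>_def)
    ultimately show "y \<in> (\<Union>b\<in>Basis. \<Union>\<sigma>\<in>{1, -1}. Q b \<sigma>)" using b by blast
  qed
  then have "emeasure lborel ({y. \<bar>infnorm y - r\<bar> < t} \<inter> ball x \<rho>)
      \<le> emeasure lborel (\<Union>b\<in>Basis. \<Union>\<sigma>\<in>{1, -1}. Q b \<sigma>)"
    by (intro emeasure_mono) (auto simp: Q_def)
  also have "\<dots> \<le> (\<Sum>b\<in>Basis. emeasure lborel (\<Union>\<sigma>\<in>{1, -1}. Q b \<sigma>))"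
    by (intro emeasure_subadditive_finite) (auto simp: Q_def)
  also have "\<dots> \<le> (\<Sum>b\<in>Basis. \<Sum>\<sigma>\<in>{1, -1}. emeasure lborel (Q b \<sigma>))"
    by (intro sum_mono emeasure_subadditive_finite) (auto simp: Q_def)
  also have "\<dots> = (\<Sum>b\<in>(Basis::'a set). \<Sum>\<sigma>\<in>{1, -1::real}. ennreal (2 * t * (2 * \<rho>) powr (real DIM('a) - 1)))"
    unfolding Q_def using assms by (intro sum.cong refl emeasure_slab_box)
  also have "\<dots> = (\<Sum>b\<in>(Basis::'a set). ennreal (\<Sum>\<sigma>\<in>{1, -1::real}. 2 * t * (2 * \<rho>) powr (real DIM('a) - 1)))"
    using assms by (intro sum.cong refl sum_ennreal) auto
  also have "\<dots> = ennreal (\<Sum>b\<in>(Basis::'a set). \<Sum>\<sigma>\<in>{1, -1::real}. 2 * t * (2 * \<rho>) powr (real DIM('a) - 1))"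
    using assms by (intro sum_ennreal) auto
  also have "(\<Sum>b\<in>(Basis::'a set). \<Sum>\<sigma>\<in>{1, -1::real}. 2 * t * (2 * \<rho>) powr (real DIM('a) - 1))
      = 4 * real DIM('a) * 2 powr (real DIM('a) - 1) * t * \<rho> powr (real DIM('a) - 1)"
    using assms by (simp add: powr_mult)
  finally show ?thesis .
qed

lemma cube_shell_codim_one_layer:
  assumes "0 \<le> r"
  shows "codim_one_layer (\<lambda>x::'a::euclidean_space. \<bar>infnorm x - r\<bar>)
      (4 * real DIM('a) * 2 powr (real DIM('a) - 1)) (sqrt DIM('a) * (r + 1))"
proof
  fix x y :: 'a
  show "\<bar>\<bar>infnorm x - r\<bar> - \<bar>infnorm y - r\<bar>\<bar> \<le> norm (x - y)"
    using absdiff_infnorm[of x y] infnorm_le_norm[of "x - y"] by linarith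
  show "norm x < sqrt DIM('a) * (r + 1)" if "\<bar>infnorm x - r\<bar> < 1"
  proof -
    have "norm x \<le> sqrt DIM('a) * infnorm x" by (rule norm_le_infnorm)
    also have "\<dots> < sqrt DIM('a) * (r + 1)" using that by (intro mult_strict_left_mono) auto
    finally show ?thesis .
  qed
qed (use assms emeasure_cube_shell in auto)

text \<open>A cube surface costs nothing: the bound in \<open>energy_bump_le\<close> tends to zero because \<open>s < 1\<close> and \<open>s * p = 1\<close>
force \<open>p > 1\<close>.\<close>
lemma exists_cheap_bump:
  fixes s p q r :: real
  assumes "0 \<le> r" "0 < s" "s < 1" "s * p = 1" "1 \<le> q"
    and int: "real DIM('a::euclidean_space) < (real DIM('a) + s * q) * (p / q)" and "0 < \<epsilon>"
  shows "\<exists>g :: 'a \<Rightarrow> real. continuous_on UNIV g \<and> (\<forall>x. 0 \<le> g x \<and> g x \<le> 1)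
    \<and> (\<forall>x. infnorm x = r \<longrightarrow> g x = 1) \<and> (\<forall>x. 1 \<le> \<bar>infnorm x - r\<bar> \<longrightarrow> g x = 0)
    \<and> energy s p q g \<le> ennreal \<epsilon>"
proof -
  interpret codim_one_layer "\<lambda>x::'a. \<bar>infnorm x - r\<bar>"
    "4 * real DIM('a) * 2 powr (real DIM('a) - 1)" "sqrt DIM('a) * (r + 1)"
    using assms(1) by (rule cube_shell_codim_one_layer)
  have "0 < p" using assms by (metis zero_less_mult_pos zero_less_one)
  have "1 < p"
  proof (rule ccontr)
    assume "\<not> 1 < p"
    then have "s * p \<le> s * 1" using assms by (intro mult_left_mono) auto
    then show False using assms by simp
  qed
  obtain C where C: "0 \<le> C"
    "\<And>N. 1 \<le> N \<Longrightarrow> energy s p q (bump N) \<le> ennreal (C * (real N powr (1 - p) + real N powr - (p / q)))"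
    by (rule energy_bump_le[OF assms(2,3) \<open>0 < p\<close> assms(4,5) int]) blast
  have "(\<lambda>N. C * (real N powr (1 - p) + real N powr - (p / q))) \<longlonglongrightarrow> C * (0 + 0)"
    using \<open>1 < p\<close> assms
    by (intro tendsto_mult tendsto_add tendsto_const tendsto_neg_powr filterlim_real_sequentially) auto
  then have "\<forall>\<^sub>F N in sequentially. C * (real N powr (1 - p) + real N powr - (p / q)) < \<epsilon>"
    using \<open>0 < \<epsilon>\<close> by (auto dest: order_tendstoD(2))
  then have "\<forall>\<^sub>F N in sequentially. C * (real N powr (1 - p) + real N powr - (p / q)) < \<epsilon> \<and> 1 \<le> N"
    using eventually_ge_at_top by (rule eventually_conj)
  then obtain N where N: "C * (real N powr (1 - p) + real N powr - (p / q)) < \<epsilon>" "1 \<le> N"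
    by (auto simp: eventually_sequentially)
  have "energy s p q (bump N) \<le> ennreal \<epsilon>"
    using C(2)[OF N(2)] N(1) by (meson ennreal_leI less_imp_le order_trans)
  then show ?thesis
    using continuous_bump bump_nonneg bump_le_1 bump_eq_1 bump_eq_0 N(2)
    by (intro exI[of _ "bump N"]) auto
qed

section \<open>Combining countably many bumps\<close>

text \<open>A substitute for the triangle inequality that treats \<open>a < 1\<close> and \<open>a > 1\<close> together. If the right side
is \<open>F\<close>, then each \<open>f k\<close> is at most \<open>F powr (1 / a)\<close> times \<open>1 / 2 ^ (k + 1)\<close>, and these weights have sum one.\<close>
lemma ennreal_powr_suminf_le:
  assumes "0 < a"
  shows "ennreal_powr (\<Sum>k. f k) a \<le> (\<Sum>k. ennreal ((2 ^ (k + 1)) powr a) * ennreal_powr (f k) a)"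
proof (cases "(\<Sum>k. ennreal ((2 ^ (k + 1)) powr a) * ennreal_powr (f k) a)")
  case (real F)
  have fk: "f k \<le> ennreal (F powr (1 / a) / 2 * (1 / 2) ^ k)" for k
  proof -
    have "ennreal ((2 ^ (k + 1)) powr a) * ennreal_powr (f k) a \<le> ennreal F"
      unfolding real(2)[symmetric] by (rule term_le_suminf_ennreal)
    moreover have "f k \<noteq> \<infinity>"
    proof
      assume "f k = \<infinity>"
      then have "ennreal ((2 ^ (k + 1)) powr a) * ennreal_powr (f k) a = \<infinity>"
        by (simp add: ennreal_powr_def ennreal_mult_top)
      with calculation show False by (simp add: top_unique)
    qed
    then obtain v where v: "0 \<le> v" "f k = ennreal v" by (cases "f k") auto
    ultimately have "ennreal ((2 ^ (k + 1)) powr a * v powr a) \<le> ennreal F"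
      by (simp add: ennreal_powr_def ennreal_mult'[symmetric])
    then have "(2 ^ (k + 1) * v) powr a \<le> F"
      using real v by (subst powr_mult) auto
    then have "((2 ^ (k + 1) * v) powr a) powr (1 / a) \<le> F powr (1 / a)"
      using assms by (intro powr_mono2) auto
    then have "2 ^ (k + 1) * v \<le> F powr (1 / a)"
      using assms v by (simp add: powr_powr)
    then have "v \<le> F powr (1 / a) / 2 * (1 / 2) ^ k"
      by (simp add: field_simps power_divide)
    then show ?thesis using v by (auto intro: ennreal_leI)
  qed
  have "(\<Sum>k. f k) \<le> (\<Sum>k. ennreal (F powr (1 / a) / 2 * (1 / 2) ^ k))"
    by (intro suminf_le fk) auto
  also have "\<dots> = ennreal (F powr (1 / a) / 2 / (1 - 1 / 2))"
    by (rule suminf_ennreal_geometric) auto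
  finally have "(\<Sum>k. f k) \<le> ennreal (F powr (1 / a))" by simp
  then have "ennreal_powr (\<Sum>k. f k) a \<le> ennreal ((F powr (1 / a)) powr a)"
    using assms by (intro ennreal_powr_le) auto
  then show ?thesis using real assms by (simp add: powr_powr)
qed simp

lemma borel_measurable_gagliardo:
  fixes u :: "'a::euclidean_space \<Rightarrow> real"
  assumes [measurable]: "u \<in> borel_measurable borel"
  shows "gagliardo s q u \<in> borel_measurable borel"
proof -
  have "(\<lambda>x. \<integral>\<^sup>+ y. ennreal (\<bar>u x - u y\<bar> powr q / norm (x - y) powr (real DIM('a) + s * q)) \<partial>lborel)
      \<in> borel_measurable borel"
    by measurable
  then show ?thesis by (simp add: gagliardo_def[abs_def])
qed

text \<open>Each increment of \<open>u\<close> is dominated by that of some \<open>f k\<close>, which may vary with the pair of points;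
this holds for a pointwise maximum of the \<open>f k\<close>, and bounds the \<open>q\<close>-th power of an increment by a sum
without a loss from the triangle inequality.\<close>
lemma energy_countable_subadditive:
  fixes u :: "'a::euclidean_space \<Rightarrow> real"
  assumes f: "\<And>k::nat. f k \<in> borel_measurable borel"
    and dom: "\<And>x y. \<exists>k. \<bar>u x - u y\<bar> \<le> \<bar>f k x - f k y\<bar>"
    and "0 < p" "0 < q"
  shows "energy s p q u \<le> (\<Sum>k. ennreal ((2 ^ (k + 1)) powr (p / q)) * energy s p q (f k))"
proof -
  note [measurable] = f
  have powr [measurable]: "(\<lambda>x. ennreal_powr (gagliardo s q (f k) x) (p / q)) \<in> borel_measurable borel" for k
    using borel_measurable_gagliardo[OF f, of s q k] unfolding ennreal_powr_def by measurable
  have mono: "ennreal_powr a c \<le> ennreal_powr b c" if "a \<le> b" "0 \<le> c" for a b c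
    using that enn2real_mono[of a b]
    by (auto simp: ennreal_powr_def top_unique less_top intro!: ennreal_leI powr_mono2)
  have gag: "gagliardo s q u x \<le> (\<Sum>k. gagliardo s q (f k) x)" for x
  proof -
    have "gagliardo s q u x
        \<le> (\<integral>\<^sup>+ y. (\<Sum>k. ennreal (\<bar>f k x - f k y\<bar> powr q / norm (x - y) powr (real DIM('a) + s * q))) \<partial>lborel)"
      unfolding gagliardo_def
    proof (rule nn_integral_mono)
      fix y
      obtain k where k: "\<bar>u x - u y\<bar> \<le> \<bar>f k x - f k y\<bar>" using dom by blast
      have "ennreal (\<bar>u x - u y\<bar> powr q / norm (x - y) powr (real DIM('a) + s * q))
          \<le> ennreal (\<bar>f k x - f k y\<bar> powr q / norm (x - y) powr (real DIM('a) + s * q))"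
        using k \<open>0 < q\<close> by (intro ennreal_leI divide_right_mono powr_mono2) auto
      also have "\<dots> \<le> (\<Sum>k. ennreal (\<bar>f k x - f k y\<bar> powr q / norm (x - y) powr (real DIM('a) + s * q)))"
        by (rule term_le_suminf_ennreal)
      finally show "ennreal (\<bar>u x - u y\<bar> powr q / norm (x - y) powr (real DIM('a) + s * q)) \<le> \<dots>" .
    qed
    also have "\<dots> = (\<Sum>k. gagliardo s q (f k) x)"
      unfolding gagliardo_def by (intro nn_integral_suminf) measurable
    finally show ?thesis .
  qed
  have "energy s p q u
      \<le> (\<integral>\<^sup>+ x. (\<Sum>k. ennreal ((2 ^ (k + 1)) powr (p / q)) * ennreal_powr (gagliardo s q (f k) x) (p / q)) \<partial>lborel)"
    unfolding energy_def
  proof (rule nn_integral_mono)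
    fix x
    have "ennreal_powr (gagliardo s q u x) (p / q) \<le> ennreal_powr (\<Sum>k. gagliardo s q (f k) x) (p / q)"
      using assms by (intro mono gag) auto
    also have "\<dots> \<le> (\<Sum>k. ennreal ((2 ^ (k + 1)) powr (p / q)) * ennreal_powr (gagliardo s q (f k) x) (p / q))"
      using assms by (intro ennreal_powr_suminf_le) auto
    finally show "ennreal_powr (gagliardo s q u x) (p / q) \<le> \<dots>" .
  qed
  also have "\<dots> = (\<Sum>k. ennreal ((2 ^ (k + 1)) powr (p / q)) * energy s p q (f k))"
    unfolding energy_def by (subst nn_integral_suminf) (auto simp: nn_integral_cmult)
  finally show ?thesis .
qed

text \<open>Bumps around the cube surfaces of radii \<open>4 * k + 2\<close> have disjoint supports, and the one around the
\<open>k\<close>-th surface can be chosen so cheap that the weighted sum of \<open>energy_countable_subadditive\<close>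
converges. Their supremum \<open>u\<close> is locally a finite sum, hence continuous.\<close>
theorem exists_energy_finite_oscillating:
  fixes s p q :: real
  assumes "0 < s" "s < 1" "s * p = 1" "1 \<le> q"
    and int: "real DIM('a::euclidean_space) < (real DIM('a) + s * q) * (p / q)"
  obtains u :: "'a::euclidean_space \<Rightarrow> real" where "continuous_on UNIV u" "\<And>x. 0 \<le> u x \<and> u x \<le> 1" "energy s p q u < \<infinity>"
    "\<And>x k. infnorm x = 4 * real k + 2 \<Longrightarrow> u x = 1" "\<And>x k. infnorm x = 4 * real k \<Longrightarrow> u x = 0"
proof -
  have p: "0 < p" using assms by (metis zero_less_mult_pos zero_less_one)
  define w where "w k = (2 ^ (k + 1)) powr (p / q)" for k :: nat
  have w: "0 < w k" for k by (simp add: w_def)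
  have "\<forall>k. \<exists>g :: 'a \<Rightarrow> real. continuous_on UNIV g \<and> (\<forall>x. 0 \<le> g x \<and> g x \<le> 1)
    \<and> (\<forall>x. infnorm x = 4 * real k + 2 \<longrightarrow> g x = 1) \<and> (\<forall>x. 1 \<le> \<bar>infnorm x - (4 * real k + 2)\<bar> \<longrightarrow> g x = 0)
    \<and> energy s p q g \<le> ennreal ((1 / 2) ^ k / w k)"
    using w by (intro allI exists_cheap_bump assms) auto
  from choice[OF this] obtain g :: "nat \<Rightarrow> 'a \<Rightarrow> real" where P:
    "\<forall>k. continuous_on UNIV (g k) \<and> (\<forall>x. 0 \<le> g k x \<and> g k x \<le> 1)
      \<and> (\<forall>x. infnorm x = 4 * real k + 2 \<longrightarrow> g k x = 1)
      \<and> (\<forall>x. 1 \<le> \<bar>infnorm x - (4 * real k + 2)\<bar> \<longrightarrow> g k x = 0)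
      \<and> energy s p q (g k) \<le> ennreal ((1 / 2) ^ k / w k)"
    by (rule exE)
  have g: "continuous_on UNIV (g k)" "0 \<le> g k x" "g k x \<le> 1"
      "infnorm x = 4 * real k + 2 \<Longrightarrow> g k x = 1"
      "1 \<le> \<bar>infnorm x - (4 * real k + 2)\<bar> \<Longrightarrow> g k x = 0"
      "energy s p q (g k) \<le> ennreal ((1 / 2) ^ k / w k)" for k x
    using P by blast+
  \<comment> \<open>The index of the only bump that can be different from zero at \<open>x\<close>.\<close>
  define \<kappa> where "\<kappa> x = nat \<lfloor>infnorm x / 4\<rfloor>" for x :: 'a
  define u where "u x = g (\<kappa> x) x" for x
  have \<kappa>: "\<kappa> x = k" if "4 * real k \<le> infnorm x" "infnorm x < 4 * real k + 4" for x k
  proof -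
    have "\<lfloor>infnorm x / 4\<rfloor> = int k" using that by (simp add: floor_eq_iff)
    then show ?thesis by (simp add: \<kappa>_def)
  qed
  have off: "g k x = 0" if "k \<noteq> \<kappa> x" for k x
  proof (rule g(5), rule ccontr)
    assume "\<not> 1 \<le> \<bar>infnorm x - (4 * real k + 2)\<bar>"
    then have "4 * real k \<le> infnorm x" "infnorm x < 4 * real k + 4" by linarith+
    from \<kappa>[OF this] that show False by simp
  qed
  have g_le: "g k x \<le> u x" for k x
    using off[of k x] g(2)[of "\<kappa> x" x] by (cases "k = \<kappa> x") (auto simp: u_def)
  \<comment> \<open>As \<open>u\<close> is at least every bump and equal to one of them at each point, the bump that is active at the higher value dominates the increment.\<close>
  have dom: "\<exists>k. \<bar>u x - u y\<bar> \<le> \<bar>g k x - g k y\<bar>" for x y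
  proof (cases "u y \<le> u x")
    case True
    then show ?thesis using g_le[of "\<kappa> x" y] by (intro exI[of _ "\<kappa> x"]) (auto simp: u_def)
  next
    case False
    then show ?thesis using g_le[of "\<kappa> y" x] by (intro exI[of _ "\<kappa> y"]) (auto simp: u_def)
  qed
  have "isCont u x" for x
  proof -
    define M where "M = \<kappa> x + 1"
    define S where "S = {y::'a. infnorm y < 4 * real M}"
    have "open S" unfolding S_def by (intro open_Collect_less continuous_intros)
    have "x \<in> S" unfolding S_def M_def \<kappa>_def by simp linarith
    have eq: "(\<Sum>k<M. g k y) = u y" if "y \<in> S" for y
    proof -
      have "\<lfloor>infnorm y / 4\<rfloor> < int M" using that by (simp add: S_def floor_less_iff)
      then have "\<kappa> y < M" using infnorm_pos_le[of y] by (simp add: \<kappa>_def nat_less_iff)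
      then have "(\<Sum>k<M. g k y) = (\<Sum>k\<in>{\<kappa> y}. g k y)"
        using off by (intro sum.mono_neutral_right) auto
      then show ?thesis by (simp add: u_def)
    qed
    have "continuous_on S (\<lambda>y. \<Sum>k<M. g k y)"
      using g(1) by (intro continuous_on_sum) (auto intro: continuous_on_subset)
    then have "continuous_on S u" using eq by (simp cong: continuous_on_cong)
    then show ?thesis using \<open>open S\<close> \<open>x \<in> S\<close> by (simp add: continuous_on_eq_continuous_at)
  qed
  then have "continuous_on UNIV u" by (simp add: continuous_on_eq_continuous_at)
  moreover have "energy s p q u < \<infinity>"
  proof -
    have "energy s p q u \<le> (\<Sum>k. ennreal (w k) * energy s p q (g k))"
      unfolding w_def using g(1) dom p assms
      by (intro energy_countable_subadditive) (auto intro: borel_measurable_continuous_onI)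
    also have "\<dots> \<le> (\<Sum>k. ennreal (1 * (1 / 2) ^ k))"
    proof (rule suminf_le)
      fix k
      have "ennreal (w k) * energy s p q (g k) \<le> ennreal (w k) * ennreal ((1 / 2) ^ k / w k)"
        by (intro mult_left_mono g(6)) auto
      also have "\<dots> = ennreal (1 * (1 / 2) ^ k)"
        using w[of k] by (simp add: ennreal_mult'[symmetric])
      finally show "ennreal (w k) * energy s p q (g k) \<le> ennreal (1 * (1 / 2) ^ k)" .
    qed auto
    also have "\<dots> = ennreal (1 / (1 - 1 / 2))" by (rule suminf_ennreal_geometric) auto
    finally show ?thesis by (auto simp: less_top[symmetric] top_unique)
  qed
  moreover have "u x = 1" if "infnorm x = 4 * real k + 2" for x k
    using \<kappa>[of k x] that g(4)[OF that] by (simp add: u_def)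
  moreover have "u x = 0" if "infnorm x = 4 * real k" for x k
    using \<kappa>[of k x] that g(5)[of x k] by (simp add: u_def)
  ultimately show thesis using g(2,3) by (intro that[of u]) (auto simp: u_def)
qed

section \<open>Curves to infinity\<close>

lemma curve_hits_cube:
  fixes \<gamma> :: "real \<Rightarrow> 'a::euclidean_space"
  assumes cont: "continuous_on {0..} \<gamma>" and inf: "filterlim (\<lambda>t. norm (\<gamma> t)) at_top at_top"
    and "0 \<le> T" "infnorm (\<gamma> T) \<le> r"
  shows "\<exists>t\<ge>T. infnorm (\<gamma> t) = r"
proof -
  have "\<forall>\<^sub>F t in at_top. sqrt DIM('a) * r \<le> norm (\<gamma> t)"
    using inf by (simp add: filterlim_at_top)
  then have "\<forall>\<^sub>F t in at_top. sqrt DIM('a) * r \<le> norm (\<gamma> t) \<and> T \<le> t"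
    using eventually_ge_at_top by (rule eventually_conj)
  then obtain T' where T': "sqrt DIM('a) * r \<le> norm (\<gamma> T')" "T \<le> T'"
    by (auto simp: eventually_at_top_linorder)
  have "sqrt DIM('a) * r \<le> sqrt DIM('a) * infnorm (\<gamma> T')"
    using T'(1) norm_le_infnorm[of "\<gamma> T'"] by linarith
  then have "r \<le> infnorm (\<gamma> T')" by simp
  moreover have "continuous_on {T..T'} (\<lambda>t. infnorm (\<gamma> t))"
    using assms by (intro continuous_intros continuous_on_subset[OF cont]) auto
  ultimately show ?thesis
    using IVT'[of "\<lambda>t. infnorm (\<gamma> t)" T r T'] T' assms(4) by auto
qed

theorem proposition1p10:
  fixes s p q :: real
  assumes "CARD('n::finite) \<ge> 2"
    and "0 < s" and "s < 1"
    and "0 < p"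
    and "s * p = 1"
    and "1 \<le> q" and "q < real CARD('n) * p / (real CARD('n) - s * p)"
  shows "\<exists>u :: real ^ 'n \<Rightarrow> real.
           bounded (range u) \<and> continuous_on UNIV u \<and> u \<in> W_dot s p q \<and>
           \<not> (\<exists>\<gamma> :: real \<Rightarrow> real ^ 'n.
                continuous_on {0..} \<gamma> \<and> \<gamma> 0 = 0 \<and>
                filterlim (\<lambda>t. norm (\<gamma> t)) at_top at_top \<and>
                (\<exists>L. ((\<lambda>t. u (\<gamma> t)) \<longlongrightarrow> L) at_top))"
proof -
  \<comment> \<open>With \<open>s * p = 1\<close>, the upper bound on \<open>q\<close> is the integrability of the tail at infinity.\<close>
  let ?n = "real CARD('n)"
  have "q * (?n - 1) < ?n * p"
    using assms(1,7) by (simp add: \<open>s * p = 1\<close> pos_less_divide_eq)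
  then have "?n * q < ?n * p + s * p * q"
    using \<open>s * p = 1\<close> by (simp add: algebra_simps)
  then have "?n < (?n + s * q) * (p / q)"
    using \<open>1 \<le> q\<close> by (simp add: field_simps)
  then have int: "real DIM(real ^ 'n) < (real DIM(real ^ 'n) + s * q) * (p / q)"
    by simp
  obtain u :: "real ^ 'n \<Rightarrow> real" where u: "continuous_on UNIV u" "\<And>x. 0 \<le> u x \<and> u x \<le> 1"
      "energy s p q u < \<infinity>"
      "\<And>x k. infnorm x = 4 * real k + 2 \<Longrightarrow> u x = 1" "\<And>x k. infnorm x = 4 * real k \<Longrightarrow> u x = 0"
    by (rule exists_energy_finite_oscillating[OF assms(2,3,5,6) int]) blast
  have "bounded (range u)"
    using u(2) by (intro boundedI[of _ 1]) auto
  moreover have "u \<in> W_dot s p q"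
  proof -
    have "u \<in> borel_measurable lebesgue"
      using borel_measurable_continuous_onI[OF u(1)] by (simp add: measurable_completion)
    moreover have "W_seminorm_integral s p q u = energy s p q u"
      by (simp add: W_seminorm_integral_def energy_def gagliardo_def nn_integral_completion)
    ultimately show ?thesis using u(3) by (simp add: W_dot_def)
  qed
  moreover have False if \<gamma>: "continuous_on {0..} \<gamma>" "filterlim (\<lambda>t. norm (\<gamma> t)) at_top at_top"
    and L: "((\<lambda>t. u (\<gamma> t)) \<longlongrightarrow> L) at_top" for \<gamma> :: "real \<Rightarrow> real ^ 'n" and L
  proof -
    have "\<forall>\<^sub>F t in at_top. dist (u (\<gamma> t)) L < 1 / 2"
      using L by (rule tendstoD) simp
    then obtain T where T: "\<And>t. T \<le> t \<Longrightarrow> dist (u (\<gamma> t)) L < 1 / 2"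
      by (auto simp: eventually_at_top_linorder)
    obtain k :: nat where k: "infnorm (\<gamma> (max 0 T)) \<le> 4 * real k"
      using real_arch_simple[of "infnorm (\<gamma> (max 0 T)) / 4"] by (auto simp: field_simps)
    obtain t1 where t1: "T \<le> t1" "infnorm (\<gamma> t1) = 4 * real k"
      using curve_hits_cube[OF \<gamma>, of "max 0 T" "4 * real k"] k by auto
    obtain t2 where t2: "T \<le> t2" "infnorm (\<gamma> t2) = 4 * real k + 2"
      using curve_hits_cube[OF \<gamma>, of "max 0 T" "4 * real k + 2"] k by auto
    show False
      using T[OF t1(1)] T[OF t2(1)] u(5)[OF t1(2)] u(4)[OF t2(2)] by (simp add: dist_real_def)
  qed
  ultimately show ?thesis using u(1) by blast
qed

end
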